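(* Let $s\ge -\tfrac12$, let $k\ge 1$ be an integer, and let $\mathbf G_1,\mathbf G_2\in\mathcal P(\mathbb R^{+k})$ satisfy $$\Sigma_{s,k}=\mathbf G_1\bigcirc_{s,k}\mathbf G_2 .$$ Then $\mathbf G_1$ and $\mathbf G_2$ are both Rayleighian distributions. More precisely, there exist nonnegative numbers $\lambda_{i,r}$ ($i=1,2$; $r=1,\dots,k$) such that, for $i=1,2$, $$\mathbf G_i=T_{\lambda_{i,1}}\sigma_s\times T_{\lambda_{i,2}}\sigma_s\times\cdots\times T_{\lambda_{i,k}}\sigma_s ,$$ for each $i=1,2$ the number of non-zero coefficients among $\lambda_{i,1},\dots,\lambda_{i,k}$ equals the dimension of $\mathbf G_i$, and $$\lambda_{1,r}^2+\lambda_{2,r}^2=1,\qquad r=1,2,\dots,k .$$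
   Context: Notation. $\mathbb R^+=[0,\infty)$, $\mathbb R^{+k}=[0,\infty)^k$, and $\mathcal P(E)$ is the set of Borel probability measures on $E$. $\delta_z$ is the unit mass at $z$, and $\times$ between measures is the product measure. For a real number $c$ and the distribution $\mu$ of a random variable $X$, $T_c\mu$ is the distribution of $cX$ (so $T_0\mu=\delta_0$). Kingman convolution. For $s>-\tfrac12$ and $\mu,\nu\in\mathcal P(\mathbb R^+)$, $\mu\circ_s\nu\in\mathcal P(\mathbb R^+)$ is defined by: for every bounded continuous $f$ on $\mathbb R^+$, $$\int_0^\infty f\,d(\mu\circ_s\nu)=\frac{\Gamma(s+1)}{\sqrt\pi\,\Gamma(s+\frac12)}\int_0^\infty\!\int_0^\infty\!\int_{-1}^1 f\big((x^2+2uxy+y^2)^{1/2}\big)(1-u^2)^{s-1/2}\,du\,\mu(dx)\,\nu(dy).$$ For $s=-\tfrac12$ the probability measure $\frac{\Gamma(s+1)}{\sqrt\pi\Gamma(s+1/2)}(1-u^2)^{s-1/2}du$ is replaced by its weak limit $\frac12(\delta_{-1}+\delta_1)$. $k$-dimensional Kingman convolution. For $\mathbf x=(x_1,\dots,x_k)$, $\mathbf y=(y_1,\dots,y_k)\in\mathbb R^{+k}$, put $\delta_{\mathbf x}\bigcirc_{s,k}\delta_{\mathbf y}=(\delta_{x_1}\circ_s\delta_{y_1})\times\cdots\times(\delta_{x_k}\circ_s\delta_{y_k})$. For $\mathbf G_1,\mathbf G_2\in\mathcal P(\mathbb R^{+k})$, put $\mathbf G_1\bigcirc_{s,k}\mathbf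 G_2=\iint(\delta_{\mathbf x}\bigcirc_{s,k}\delta_{\mathbf y})\,\mathbf G_1(d\mathbf x)\,\mathbf G_2(d\mathbf y)$. Rayleigh distributions. $\sigma_s$ is the probability measure on $\mathbb R^+$ with density $\frac{2(s+1)^{s+1}}{\Gamma(s+1)}x^{2s+1}\exp\{-(s+1)x^2\}$, $x>0$. The $k$-dimensional Rayleigh distribution is $\Sigma_{s,k}=\sigma_s\times\cdots\times\sigma_s$ ($k$ times). A distribution $\mathbf F\in\mathcal P(\mathbb R^{+k})$ is called Rayleighian if there are $\lambda_1,\dots,\lambda_k\ge0$ with $\mathbf F=T_{\lambda_1}\sigma_s\times\cdots\times T_{\lambda_k}\sigma_s$. Dimension. The dimension of a distribution on $\mathbb R^k$ is the dimension of the smallest affine subspace of $\mathbb R^k$ containing its support (so a point mass has dimension $0$). *)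

theory Defs
  imports "HOL-Probability.Probability"
begin

(* Borel probability measures on E, viewed as measures on the ambient space carried by E. *)
definition distributions_on :: "'a::topological_space set \<Rightarrow> 'a measure set" where
  "distributions_on E = {M \<in> space (prob_algebra borel). AE x in M. x \<in> E}"

definition orthant :: "(real^'k) set" where
  "orthant = {x. \<forall>i. 0 \<le> x $ i}"

definition scale_distr :: "real \<Rightarrow> real measure \<Rightarrow> real measure" where
  "scale_distr c \<mu> = distr \<mu> borel (\<lambda>x. c * x)"

(* The product of Borel measures on the coordinates, transported from functions to vectors. *)
definition vec_prod :: "('k::finite \<Rightarrow> real measure) \<Rightarrow> (real^'k) measure" where
  "vec_prod \<mu> = distr (Pi\<^sub>M UNIV \<mu>) borel (\<lambda>f. \<chi> i. f i)"

(* The law of the cosine u; for s = -1/2 the weak limit, the uniform law on {-1,1}. *)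
definition kingman_kernel :: "real \<Rightarrow> real measure" where
  "kingman_kernel s =
     (if s = -1/2 then distr (measure_pmf (pmf_of_set {-1, 1})) borel (\<lambda>u. u)
      else density lborel (\<lambda>u. ennreal (indicator {-1..1} u *
             (Gamma (s + 1) / (sqrt pi * Gamma (s + 1/2)) * (1 - u\<^sup>2) powr (s - 1/2)))))"

(* As a push-forward; lemma integral_kingman_conv below recovers the defining formula
   for integrals of bounded continuous functions. *)
definition kingman_conv :: "real \<Rightarrow> real measure \<Rightarrow> real measure \<Rightarrow> real measure" where
  "kingman_conv s \<mu> \<nu> =
     distr (\<mu> \<Otimes>\<^sub>M (\<nu> \<Otimes>\<^sub>M kingman_kernel s)) borel
       (\<lambda>(x, y, u). sqrt (x\<^sup>2 + 2 * u * x * y + y\<^sup>2))"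

definition kingman_conv_point :: "real \<Rightarrow> real^'k \<Rightarrow> real^'k \<Rightarrow> (real^'k) measure" where
  "kingman_conv_point s x y =
     vec_prod (\<lambda>i. kingman_conv s (return borel (x $ i)) (return borel (y $ i)))"

(* The mixture is taken in the Giry monad; measurable_kingman_conv_point below shows that
   the kernel has the measurability on which the meaning of bind depends, and
   emeasure_kingman_conv_vec writes the mixture as an iterated integral. *)
definition kingman_conv_vec ::
  "real \<Rightarrow> (real^'k) measure \<Rightarrow> (real^'k) measure \<Rightarrow> (real^'k) measure" where
  "kingman_conv_vec s G\<^sub>1 G\<^sub>2 = (G\<^sub>1 \<Otimes>\<^sub>M G\<^sub>2) \<bind> (\<lambda>(x, y). kingman_conv_point s x y)"

definition rayleigh :: "real \<Rightarrow> real measure" where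
  "rayleigh s = density lborel (\<lambda>x. ennreal (if 0 < x then
     2 * (s + 1) powr (s + 1) / Gamma (s + 1) * x powr (2 * s + 1) * exp (- (s + 1) * x\<^sup>2)
     else 0))"

definition rayleigh_vec :: "real \<Rightarrow> (real^'k) measure" where
  "rayleigh_vec s = vec_prod (\<lambda>_. rayleigh s)"

definition rayleighian :: "real \<Rightarrow> (real^'k) measure \<Rightarrow> bool" where
  "rayleighian s F \<longleftrightarrow>
     (\<exists>l :: 'k \<Rightarrow> real. (\<forall>r. 0 \<le> l r) \<and> F = vec_prod (\<lambda>r. scale_distr (l r) (rayleigh s)))"

definition distr_support :: "'a::topological_space measure \<Rightarrow> 'a set" where
  "distr_support M = {x. \<forall>U. open U \<longrightarrow> x \<in> U \<longrightarrow> emeasure M U > 0}"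

definition distr_dim :: "(real^'k) measure \<Rightarrow> int" where
  "distr_dim M = aff_dim (affine hull (distr_support M))"


lemma sets_kingman_kernel [measurable_cong, simp]: "sets (kingman_kernel s) = sets borel"
  by (simp add: kingman_kernel_def)

lemma kingman_normalization:
  fixes s :: real
  assumes s: "s > -1/2"
  shows "(\<integral>\<^sup>+ u. ennreal (indicator {-1..1} u * (1 - u\<^sup>2) powr (s - 1/2)) \<partial>lborel)
           = ennreal (sqrt pi * Gamma (s + 1/2) / Gamma (s + 1))"
proof -
  let ?a = "s + 1/2"
  have a: "?a > 0" using s by simp
  have "((\<lambda>t. t powr (?a - 1) * (1 - t) powr (?a - 1)) has_integral Beta ?a ?a) {0..1}"
    by (rule has_integral_Beta_real[OF a a])
  from nn_integral_has_integral_lebesgue'[OF _ this]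
  have B: "(\<integral>\<^sup>+ t. ennreal (t powr (?a - 1) * (1 - t) powr (?a - 1)) * indicator {0..1} t \<partial>lborel)
      = ennreal (Beta ?a ?a)" by simp
  have "(\<integral>\<^sup>+ u. ennreal (indicator {-1..1} u * (1 - u\<^sup>2) powr (s - 1/2)) \<partial>lborel)
      = 2 * (\<integral>\<^sup>+ t. ennreal (indicator {-1..1} (-1 + 2 * t) * (1 - (-1 + 2 * t)\<^sup>2) powr (s - 1/2)) \<partial>lborel)"
    by (subst nn_integral_real_affine[where c = 2 and t = "-1"]) auto
  also have "(\<lambda>t. ennreal (indicator {-1..1} (-1 + 2 * t) * (1 - (-1 + 2 * t)\<^sup>2) powr (s - 1/2)))
      = (\<lambda>t. ennreal (4 powr (?a - 1)) * (ennreal (t powr (?a - 1) * (1 - t) powr (?a - 1)) * indicator {0..1::real} t))"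
  proof
    fix t :: real
    show "ennreal (indicator {-1..1} (-1 + 2 * t) * (1 - (-1 + 2 * t)\<^sup>2) powr (s - 1/2))
       = ennreal (4 powr (?a - 1)) * (ennreal (t powr (?a - 1) * (1 - t) powr (?a - 1)) * indicator {0..1::real} t)"
    proof (cases "t \<in> {0..1}")
      case True
      have "1 - (-1 + 2 * t)\<^sup>2 = 4 * (t * (1 - t))" by (simp add: power2_eq_square algebra_simps)
      then have "(1 - (-1 + 2 * t)\<^sup>2) powr (s - 1/2) = 4 powr (?a - 1) * (t powr (?a - 1) * (1 - t) powr (?a - 1))"
        using True by (simp add: powr_mult)
      then show ?thesis using True by (simp add: ennreal_mult')
    next
      case False
      then show ?thesis by (auto simp: indicator_def)
    qed
  qed
  also have "2 * (\<integral>\<^sup>+ t. ennreal (4 powr (?a - 1)) * (ennreal (t powr (?a - 1) * (1 - t) powr (?a - 1)) * indicator {0..1::real} t) \<partial>lborel)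
     = ennreal (2 * 4 powr (?a - 1) * Beta ?a ?a)"
    by (subst nn_integral_cmult, simp, subst B, simp add: ennreal_mult' mult.assoc)
  also have "2 * 4 powr (?a - 1) * Beta ?a ?a = sqrt pi * Gamma ?a / Gamma (s + 1)"
  proof -
    have "complex_of_real ?a \<notin> \<int>\<^sub>\<le>\<^sub>0" "complex_of_real ?a + 1/2 \<notin> \<int>\<^sub>\<le>\<^sub>0"
      using a by (auto elim!: nonpos_Ints_cases simp: complex_eq_iff)
    from Gamma_legendre_duplication[OF this]
    have "complex_of_real (Gamma ?a * Gamma (?a + 1/2))
       = complex_of_real (exp ((1 - 2 * ?a) * ln 2) * sqrt pi * Gamma (2 * ?a))"
      unfolding of_real_mult Gamma_complex_of_real[symmetric] exp_of_real[symmetric] of_real_add by simp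
    then have L: "Gamma ?a * Gamma (?a + 1/2) = exp ((1 - 2 * ?a) * ln 2) * sqrt pi * Gamma (2 * ?a)"
      by (simp only: of_real_eq_iff)
    have E: "2 * 4 powr (?a - 1) * exp ((1 - 2 * ?a) * ln 2) = (1::real)"
    proof -
      have "(4::real) powr (?a - 1) = exp ((2 * ?a - 2) * ln 2)"
        using ln_realpow[of 2 2] by (simp add: powr_def algebra_simps)
      then have "2 * 4 powr (?a - 1) * exp ((1 - 2 * ?a) * ln 2)
          = 2 * exp ((2 * ?a - 2) * ln 2 + (1 - 2 * ?a) * ln (2::real))"
        by (simp only: exp_add mult.assoc)
      also have "(2 * ?a - 2) * ln 2 + (1 - 2 * ?a) * ln 2 = - ln (2::real)"
        by (simp add: algebra_simps)
      finally show ?thesis by (simp add: exp_minus)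
    qed
    have pos: "Gamma (2 * ?a) > 0" "Gamma (s + 1) > 0" using a by (auto intro!: Gamma_real_pos)
    have "Gamma ?a * Gamma (s + 1) = exp ((1 - 2 * ?a) * ln 2) * sqrt pi * Gamma (2 * ?a)"
      using L by (simp add: add.assoc)
    then have "Gamma ?a * Gamma ?a * Gamma (s + 1) * (2 * 4 powr (?a - 1))
        = (2 * 4 powr (?a - 1) * exp ((1 - 2 * ?a) * ln 2)) * sqrt pi * Gamma (2 * ?a) * Gamma ?a"
      by (simp add: algebra_simps)
    then have "Gamma ?a * Gamma ?a * Gamma (s + 1) * (2 * 4 powr (?a - 1)) = sqrt pi * Gamma (2 * ?a) * Gamma ?a"
      unfolding E by simp
    moreover have "p * (g * g / d) = q * g / G" if "g * g * G * p = q * d * g" "d > 0" "G > 0"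
      for p g d q G :: real
      using that by (simp add: field_simps)
    ultimately have "2 * 4 powr (?a - 1) * (Gamma ?a * Gamma ?a / Gamma (2 * ?a)) = sqrt pi * Gamma ?a / Gamma (s + 1)"
      using pos by blast
    then show ?thesis
      by (simp only: Beta_def mult_2)
  qed
  finally show ?thesis .
qed

lemma prob_space_kingman_kernel:
  assumes s: "s \<ge> -1/2"
  shows "prob_space (kingman_kernel s)"
proof (cases "s = -1/2")
  case True
  then show ?thesis
    by (auto simp: kingman_kernel_def intro!: prob_space.prob_space_distr prob_space_measure_pmf)
next
  case False
  let ?c = "Gamma (s + 1) / (sqrt pi * Gamma (s + 1/2))"
  have s': "s > -1/2" using s False by simp
  have G: "Gamma (s + 1) > 0" "Gamma (s + 1/2) > 0" using s' by (auto intro!: Gamma_real_pos)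
  have "emeasure (kingman_kernel s) (space (kingman_kernel s)) =
     (\<integral>\<^sup>+ u. ennreal ?c * ennreal (indicator {-1..1} u * (1 - u\<^sup>2) powr (s - 1/2)) \<partial>lborel)"
    using False G
    by (auto simp: kingman_kernel_def emeasure_density ennreal_mult'[symmetric] mult_ac intro!: nn_integral_cong)
  also have "\<dots> = ennreal ?c * ennreal (sqrt pi * Gamma (s + 1/2) / Gamma (s + 1))"
    by (subst nn_integral_cmult) (auto simp: kingman_normalization[OF s'])
  also have "\<dots> = 1"
    using G by (simp add: ennreal_mult'[symmetric])
  finally show ?thesis by (rule prob_spaceI)
qed

lemma AE_kingman_kernel: "AE u in kingman_kernel s. u \<in> {-1..1}"
proof (cases "s = -1/2")
  case True
  have "AE u in distr (measure_pmf (pmf_of_set {-1, 1})) borel (\<lambda>u. u :: real). u \<in> {-1..1}"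
    by (subst AE_distr_iff) (auto simp: AE_measure_pmf_iff)
  then show ?thesis using True by (simp only: kingman_kernel_def simp_thms if_True)
next
  case False
  then show ?thesis
    by (simp only: kingman_kernel_def if_False) (subst AE_density, auto split: split_indicator)
qed

lemma measurable_kingman_fun [measurable]:
  "(\<lambda>(x, y, u). sqrt (x\<^sup>2 + 2 * u * x * y + y\<^sup>2)) \<in> borel_measurable (borel \<Otimes>\<^sub>M (borel \<Otimes>\<^sub>M (borel :: real measure)))"
  by measurable

lemma kingman_radicand_nonneg:
  fixes x y u :: real
  assumes "u \<in> {-1..1}"
  shows "0 \<le> x\<^sup>2 + 2 * u * x * y + y\<^sup>2"
proof -
  have "u\<^sup>2 \<le> 1" using assms by (simp add: abs_le_iff abs_square_le_1)
  then have "0 \<le> (x + u * y)\<^sup>2 + (1 - u\<^sup>2) * y\<^sup>2" by simp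
  also have "\<dots> = x\<^sup>2 + 2 * u * x * y + y\<^sup>2" by (simp add: power2_eq_square algebra_simps)
  finally show ?thesis .
qed

lemma integral_kingman_conv:
  fixes f :: "real \<Rightarrow> real"
  assumes s: "s > -1/2"
    and \<mu>: "\<mu> \<in> distributions_on {0..}" and \<nu>: "\<nu> \<in> distributions_on {0..}"
    and f: "continuous_on {0..} f" "bounded (f ` {0..})"
  shows "(LINT z:{0..}|kingman_conv s \<mu> \<nu>. f z) =
    Gamma (s + 1) / (sqrt pi * Gamma (s + 1/2)) *
      (LINT x:{0..}|\<mu>. LINT y:{0..}|\<nu>. LINT u:{-1..1}|lborel.
         f (sqrt (x\<^sup>2 + 2 * u * x * y + y\<^sup>2)) * (1 - u\<^sup>2) powr (s - 1/2))"
proof -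
  let ?K = "kingman_kernel s"
  let ?c = "Gamma (s + 1) / (sqrt pi * Gamma (s + 1/2))"
  define h :: "real \<times> real \<times> real \<Rightarrow> real" where "h = (\<lambda>(x, y, u). sqrt (x\<^sup>2 + 2 * u * x * y + y\<^sup>2))"
  have G: "Gamma (s + 1) > 0" "Gamma (s + 1/2) > 0" using s by (auto intro!: Gamma_real_pos)
  have sets [measurable_cong]: "sets \<mu> = sets borel" "sets \<nu> = sets borel"
    using \<mu> \<nu> by (auto simp: distributions_on_def space_prob_algebra)
  have AE: "AE x in \<mu>. 0 \<le> x" "AE y in \<nu>. 0 \<le> y"
    using \<mu> \<nu> by (auto simp: distributions_on_def)
  interpret \<mu>: prob_space \<mu> using \<mu> by (simp add: distributions_on_def space_prob_algebra)
  interpret \<nu>: prob_space \<nu> using \<nu> by (simp add: distributions_on_def space_prob_algebra)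
  interpret K: prob_space ?K using s by (intro prob_space_kingman_kernel) simp
  interpret \<nu>K: pair_prob_space \<nu> ?K ..
  interpret P: pair_prob_space \<mu> "\<nu> \<Otimes>\<^sub>M ?K" ..
  have h [measurable]: "h \<in> borel_measurable (\<mu> \<Otimes>\<^sub>M (\<nu> \<Otimes>\<^sub>M ?K))"
    unfolding h_def by measurable
  define g where "g = (\<lambda>z. f (max 0 z))"
  have "continuous_on UNIV g"
    unfolding g_def by (intro continuous_on_compose2[OF f(1)] continuous_intros) auto
  then have g [measurable]: "g \<in> borel_measurable borel" by (rule borel_measurable_continuous_onI)
  obtain B where B: "\<And>z. norm (g z) \<le> B"
    using f(2) unfolding g_def bounded_iff by force
  then have B0: "0 \<le> B" using norm_ge_zero order_trans by blast
  define H where "H = (\<lambda>p. indicator {0..} (fst p) * (indicator {0..} (fst (snd p)) * (indicator {0..} (h p) * g (h p))))"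
  have H [measurable]: "H \<in> borel_measurable (\<mu> \<Otimes>\<^sub>M (\<nu> \<Otimes>\<^sub>M ?K))"
    unfolding H_def by measurable
  have HB: "norm (H p) \<le> B" for p
    using B[of "h p"] B0 by (auto simp: H_def indicator_def)
  have int1: "integrable (\<mu> \<Otimes>\<^sub>M (\<nu> \<Otimes>\<^sub>M ?K)) H"
    by (rule P.integrable_const_bound[of _ B]) (auto intro!: AE_I2 HB[unfolded real_norm_def])
  have int2: "integrable (\<nu> \<Otimes>\<^sub>M ?K) (\<lambda>q. H (x, q))" if "x \<in> space \<mu>" for x
    by (rule \<nu>K.integrable_const_bound[of _ B])
       (use that in \<open>auto intro!: AE_I2 HB[unfolded real_norm_def] measurable_compose[OF _ H]\<close>)
  have "AE q in \<nu> \<Otimes>\<^sub>M ?K. 0 \<le> fst q"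
    by (rule \<nu>K.AE_pair_measure, measurable) (use AE in auto)
  then have "AE p in \<mu> \<Otimes>\<^sub>M (\<nu> \<Otimes>\<^sub>M ?K). 0 \<le> fst (snd p)"
    by (intro P.AE_pair_measure, measurable)
  moreover have "AE p in \<mu> \<Otimes>\<^sub>M (\<nu> \<Otimes>\<^sub>M ?K). 0 \<le> fst p"
    by (intro P.AE_pair_measure, measurable) (use AE in auto)
  ultimately have AEH: "AE p in \<mu> \<Otimes>\<^sub>M (\<nu> \<Otimes>\<^sub>M ?K). indicator {0..} (h p) * g (h p) = H p"
    by eventually_elim (simp add: H_def)
  have inner: "(\<integral>u. H (x, y, u) \<partial>?K) = ?c * (indicator {0..} x * (indicator {0..} y *
     (LINT u:{-1..1}|lborel. f (sqrt (x\<^sup>2 + 2 * u * x * y + y\<^sup>2)) * (1 - u\<^sup>2) powr (s - 1/2))))" for x y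
  proof -
    have m: "(\<lambda>u. H (x, y, u)) \<in> borel_measurable borel"
      unfolding H_def h_def by simp
    have "(\<integral>u. H (x, y, u) \<partial>?K) =
      (\<integral>u. (indicator {-1..1} u * (?c * (1 - u\<^sup>2) powr (s - 1/2))) * H (x, y, u) \<partial>lborel)"
      using s G m by (simp add: kingman_kernel_def integral_density)
    also have "\<dots> = (\<integral>u. ?c * (indicator {0..} x * (indicator {0..} y *
       (indicator {-1..1} u *\<^sub>R (f (sqrt (x\<^sup>2 + 2 * u * x * y + y\<^sup>2)) * (1 - u\<^sup>2) powr (s - 1/2))))) \<partial>lborel)"
    proof (intro Bochner_Integration.integral_cong refl)
      fix u :: real
      show "(indicator {-1..1} u * (?c * (1 - u\<^sup>2) powr (s - 1/2))) * H (x, y, u) =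
        ?c * (indicator {0..} x * (indicator {0..} y *
       (indicator {-1..1} u *\<^sub>R (f (sqrt (x\<^sup>2 + 2 * u * x * y + y\<^sup>2)) * (1 - u\<^sup>2) powr (s - 1/2)))))"
        using kingman_radicand_nonneg[of u x y]
        by (cases "u \<in> {-1..1}") (simp_all add: H_def h_def g_def max_def)
    qed
    finally show ?thesis by (simp add: set_lebesgue_integral_def)
  qed
  have "(LINT z:{0..}|kingman_conv s \<mu> \<nu>. f z) = (\<integral>z. indicator {0..} z * g z \<partial>kingman_conv s \<mu> \<nu>)"
    unfolding set_lebesgue_integral_def g_def
    by (intro Bochner_Integration.integral_cong refl) (auto simp: indicator_def max_def)
  also have "\<dots> = (\<integral>p. indicator {0..} (h p) * g (h p) \<partial>(\<mu> \<Otimes>\<^sub>M (\<nu> \<Otimes>\<^sub>M ?K)))"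
    unfolding kingman_conv_def h_def[symmetric] by (subst integral_distr) auto
  also have "\<dots> = (\<integral>p. H p \<partial>(\<mu> \<Otimes>\<^sub>M (\<nu> \<Otimes>\<^sub>M ?K)))"
    by (rule integral_cong_AE) (use AEH in auto)
  also have "\<dots> = (\<integral>x. \<integral>q. H (x, q) \<partial>(\<nu> \<Otimes>\<^sub>M ?K) \<partial>\<mu>)"
    by (rule P.integral_fst'[OF int1, symmetric])
  also have "\<dots> = (\<integral>x. \<integral>y. \<integral>u. H (x, y, u) \<partial>?K \<partial>\<nu> \<partial>\<mu>)"
    by (intro Bochner_Integration.integral_cong refl \<nu>K.integral_fst'[symmetric] int2)
  also have "\<dots> = ?c * (LINT x:{0..}|\<mu>. LINT y:{0..}|\<nu>. LINT u:{-1..1}|lborel.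
         f (sqrt (x\<^sup>2 + 2 * u * x * y + y\<^sup>2)) * (1 - u\<^sup>2) powr (s - 1/2))"
    unfolding inner by (simp add: set_lebesgue_integral_def)
  finally show ?thesis .
qed

lemma measurable_PiM_vec: "(\<lambda>f. \<chi> i. f i) \<in> Pi\<^sub>M UNIV (\<lambda>_. borel) \<rightarrow>\<^sub>M (borel :: (real^'k) measure)"
  by (subst borel_measurable_euclidean_space) (auto simp: Basis_vec_def inner_axis)

lemma measurable_kingman_conv_point:
  assumes s: "s \<ge> -1/2"
  shows "(\<lambda>(x, y). kingman_conv_point s x y) \<in>
     (borel \<Otimes>\<^sub>M borel :: ((real^'k) \<times> (real^'k)) measure) \<rightarrow>\<^sub>M prob_algebra borel"
proof -
  let ?L = "borel \<Otimes>\<^sub>M borel :: ((real^'k) \<times> (real^'k)) measure"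
  define C where "C = (\<lambda>i (p :: (real^'k) \<times> (real^'k)).
     kingman_conv s (return borel (fst p $ i)) (return borel (snd p $ i)))"
  have nth: "(\<lambda>v. v $ i) \<in> borel_measurable (borel :: (real^'k) measure)" for i
    by (intro borel_measurable_continuous_onI continuous_intros)
  have K: "kingman_kernel s \<in> space (prob_algebra borel)"
    using prob_space_kingman_kernel[OF s] by (simp add: space_prob_algebra)
  have C: "C i \<in> ?L \<rightarrow>\<^sub>M prob_algebra borel" for i
  proof -
    have "(\<lambda>p. return borel (fst p $ i) \<Otimes>\<^sub>M (return borel (snd p $ i) \<Otimes>\<^sub>M kingman_kernel s))
        \<in> ?L \<rightarrow>\<^sub>M prob_algebra (borel \<Otimes>\<^sub>M (borel \<Otimes>\<^sub>M borel))"
      by (intro measurable_pair_prob measurable_compose[OF _ measurable_return_prob_space]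
            measurable_compose[OF measurable_fst nth] measurable_compose[OF measurable_snd nth]
            measurable_const K)
    from measurable_compose[OF this measurable_distr_prob_space[OF measurable_kingman_fun]]
    show ?thesis by (simp add: C_def kingman_conv_def)
  qed
  have Cp: "prob_space (C i p)" "sets (C i p) = sets borel" for i p
    using measurable_space[OF C, of p i] by (auto simp: space_prob_algebra space_pair_measure)
  have "(\<lambda>p. Pi\<^sub>M UNIV (\<lambda>i. C i p)) \<in> ?L \<rightarrow>\<^sub>M prob_algebra (Pi\<^sub>M UNIV (\<lambda>_. borel))"
  proof (rule measurable_prob_algebra_generated[OF sets_PiM Int_stable_prod_algebra prod_algebra_sets_into_space])
    fix p assume "p \<in> space ?L"
    show "prob_space (Pi\<^sub>M UNIV (\<lambda>i. C i p))" by (intro prob_space_PiM Cp)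
    show "sets (Pi\<^sub>M UNIV (\<lambda>i. C i p)) = sets (Pi\<^sub>M UNIV (\<lambda>_. borel))"
      by (intro sets_PiM_cong refl Cp)
  next
    fix A assume "A \<in> prod_algebra UNIV (\<lambda>_ :: 'k. borel :: real measure)"
    then obtain E where E: "A = Pi\<^sub>E UNIV E" "\<And>i. E i \<in> sets borel"
      by (auto simp: prod_algebra_eq_finite)
    have "emeasure (Pi\<^sub>M UNIV (\<lambda>i. C i p)) A = (\<Prod>i\<in>UNIV. emeasure (C i p) (E i))" for p
    proof -
      interpret product_sigma_finite "\<lambda>i. C i p"
        by (intro product_sigma_finite.intro prob_space_imp_sigma_finite Cp)
      show ?thesis unfolding E(1) by (rule emeasure_PiM) (auto simp: Cp E)
    qed
    moreover have "(\<lambda>p. emeasure (C i p) (E i)) \<in> borel_measurable ?L" for i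
      using measurable_compose[OF measurable_prob_algebraD[OF C] measurable_emeasure_subprob_algebra[OF E(2)]] .
    ultimately show "(\<lambda>p. emeasure (Pi\<^sub>M UNIV (\<lambda>i. C i p)) A) \<in> borel_measurable ?L"
      by simp
  qed
  from measurable_compose[OF this measurable_distr_prob_space[OF measurable_PiM_vec]]
  show ?thesis
    by (simp add: kingman_conv_point_def[abs_def] vec_prod_def C_def case_prod_unfold)
qed

lemma emeasure_kingman_conv_vec:
  fixes G\<^sub>1 G\<^sub>2 :: "(real^'k) measure"
  assumes s: "s \<ge> -1/2" and G: "G\<^sub>1 \<in> distributions_on E\<^sub>1" "G\<^sub>2 \<in> distributions_on E\<^sub>2"
    and A: "A \<in> sets borel"
  shows "emeasure (kingman_conv_vec s G\<^sub>1 G\<^sub>2) A =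
    (\<integral>\<^sup>+ x. \<integral>\<^sup>+ y. emeasure (kingman_conv_point s x y) A \<partial>G\<^sub>2 \<partial>G\<^sub>1)"
proof -
  have G': "prob_space G\<^sub>1" "prob_space G\<^sub>2" and sets: "sets G\<^sub>1 = sets borel" "sets G\<^sub>2 = sets borel"
    using G by (auto simp: distributions_on_def space_prob_algebra)
  interpret G\<^sub>1: prob_space G\<^sub>1 by fact
  interpret G\<^sub>2: prob_space G\<^sub>2 by fact
  interpret P: pair_prob_space G\<^sub>1 G\<^sub>2 ..
  have P: "G\<^sub>1 \<Otimes>\<^sub>M G\<^sub>2 \<in> space (prob_algebra (borel \<Otimes>\<^sub>M borel))"
    using sets by (auto simp: space_prob_algebra P.prob_space_axioms intro!: sets_pair_measure_cong)
  have m: "(\<lambda>p. emeasure (case p of (x, y) \<Rightarrow> kingman_conv_point s x y) A) \<in> borel_measurable (G\<^sub>1 \<Otimes>\<^sub>M G\<^sub>2)"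
    using measurable_compose[OF measurable_prob_algebraD[OF measurable_kingman_conv_point[OF s]]
        measurable_emeasure_subprob_algebra[OF A]]
    by (simp cong: measurable_cong_sets add: sets_pair_measure_cong[OF sets])
  have "emeasure (kingman_conv_vec s G\<^sub>1 G\<^sub>2) A =
      (\<integral>\<^sup>+ p. emeasure (case p of (x, y) \<Rightarrow> kingman_conv_point s x y) A \<partial>(G\<^sub>1 \<Otimes>\<^sub>M G\<^sub>2))"
    unfolding kingman_conv_vec_def
    by (rule emeasure_bind_prob_algebra[OF P measurable_kingman_conv_point[OF s] A])
  also have "\<dots> = (\<integral>\<^sup>+ x. \<integral>\<^sup>+ y. emeasure (kingman_conv_point s x y) A \<partial>G\<^sub>2 \<partial>G\<^sub>1)"
    using G\<^sub>2.nn_integral_fst[OF m] by simp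
  finally show ?thesis .
qed

end

(* For each coordinate the Kingman convolution is multiplicative under the transform with kernel
   bessel_clifford (s + 1) (w * x^2), where bessel_clifford a z = 0F1(a; z); with w < 0 this is the
   usual Bessel (Hankel) transform, and the Rayleigh distribution has transform exp (w / (s + 1)).
   For w >= 0 all Taylor coefficients of the kernel are nonnegative, so on a ray z * w the transforms
   of G1 and G2 are entire functions of z with nonnegative coefficients and product exp (c * z).
   As in Raikov's theorem they are zero free of order at most 1, hence exponentials, whose rate is
   the first Taylor coefficient: a combination of the second moments of the coordinates. Taking
   z = -1 gives the Bessel transform of a product of scaled Rayleigh distributions.
   Injectivity: integrating the Bessel transform against Rayleigh distributed parameters yields the
   transform with kernels exp (- t * x^2), which determines the measure by Stone-Weierstrass. *)
theory Submission
  imports Defs "HOL-Complex_Analysis.Complex_Analysis"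
begin

section \<open>The Bessel-Clifford function\<close>

text \<open>At z = - (t / 2)^2 with t > 0, \<open>bessel_clifford (s + 1) z\<close> is Gamma (s + 1)
  * (2 / t)^s * J_s(t); for s = -1/2 it is cos t. On this side the kernel is bounded and identifies
  measures. The factor argument needs the other side, w >= 0, where the kernel is unbounded and
  nothing says in advance that the transforms of the two factors are finite. Multiplicativity is
  therefore proved there, with extended nonnegative integrals, so that every exchange of sum and
  integral is monotone convergence or Tonelli. Finiteness comes afterwards: the kernel is at least
  1, hence so is each transform, and a finite product bounds both. Finiteness for all w >= 0 gives
  moments of every even order and series that converge on the whole line; the bounded side is then
  reached as a value of these series instead of by a second product formula. The Rayleigh law has
  second moment 1, so the scales are the roots of the second moments, and comparing exponents
  coordinate by coordinate gives the relation between the squares.\<close>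

definition bessel_clifford :: "real \<Rightarrow> real \<Rightarrow> real" where
  "bessel_clifford a z = (\<Sum>n. z ^ n / (fact n * pochhammer a n))"

lemma power_le_pochhammer: "a ^ n \<le> pochhammer a n" if "0 < a" for a :: real
proof (induction n)
  case (Suc n)
  have "a ^ n * a \<le> pochhammer a n * (a + real n)"
    using Suc that by (intro mult_mono) (auto intro: pochhammer_nonneg)
  then show ?case by (simp add: pochhammer_Suc mult_ac)
qed simp

lemma summable_bessel_clifford:
  fixes a z :: real
  assumes "0 < a"
  shows "summable (\<lambda>n. \<bar>z ^ n / (fact n * pochhammer a n)\<bar>)"
proof (rule summable_comparison_test')
  \<comment> \<open>Since \<open>a ^ n\<close> is at most \<open>pochhammer a n\<close>, the
    exponential series at |z| / a dominates.\<close>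
  show "summable (\<lambda>n. (\<bar>z\<bar> / a) ^ n / fact n)"
    using summable_exp[of "\<bar>z\<bar> / a"] by (simp add: field_simps)
  fix n :: nat
  have "0 < fact n * a ^ n" "fact n * a ^ n \<le> fact n * pochhammer a n"
    using assms power_le_pochhammer[OF assms, of n] by auto
  then have "\<bar>z\<bar> ^ n / (fact n * pochhammer a n) \<le> \<bar>z\<bar> ^ n / (fact n * a ^ n)"
    by (intro divide_left_mono mult_pos_pos) (use pochhammer_pos[OF assms] assms in auto)
  then show "norm \<bar>z ^ n / (fact n * pochhammer a n)\<bar> \<le> (\<bar>z\<bar> / a) ^ n / fact n"
    using pochhammer_pos[OF assms, of n]
    by (simp add: abs_mult power_abs power_divide mult.commute)
qed

lemma bessel_clifford_sums:
  assumes "0 < a"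
  shows "(\<lambda>n. z ^ n / (fact n * pochhammer a n)) sums bessel_clifford a z"
  unfolding bessel_clifford_def
  by (rule summable_sums[OF summable_rabs_cancel[OF summable_bessel_clifford[OF assms]]])

lemma bessel_clifford_ge_1:
  assumes "0 < a" "0 \<le> z"
  shows "1 \<le> bessel_clifford a z"
proof -
  have "(\<Sum>n\<in>{0}. z ^ n / (fact n * pochhammer a n)) \<le> bessel_clifford a z"
    unfolding bessel_clifford_def
    using assms pochhammer_pos[OF assms(1)]
    by (intro sum_le_suminf sums_summable[OF bessel_clifford_sums]) (auto simp: less_imp_le)
  then show ?thesis by simp
qed

lemma borel_measurable_bessel_clifford [measurable]: "bessel_clifford a \<in> borel_measurable borel"
  unfolding bessel_clifford_def[abs_def] by measurable

text \<open>The Chu-Vandermonde identity: up to the factor \<open>1 / (fact p * fact q)\<close> the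
  left side is the terminating series 2F1(-p, -q; a; 1).\<close>

lemma sum_reciprocal_fact_pochhammer:
  fixes a :: real
  assumes a: "0 < a"
  shows "(\<Sum>m | m \<le> p \<and> m \<le> q. 1 / (fact m * fact (p - m) * fact (q - m) * pochhammer a m))
     = pochhammer a (p + q) / (fact p * pochhammer a p * (fact q * pochhammer a q))"
proof -
  have c: "pochhammer (- real p) m = (- 1) ^ m * (fact p / fact (p - m))" if "m \<le> p" for p m
  proof -
    have "real p - real m + 1 = real (p - m) + 1" using that by (simp add: of_nat_diff)
    moreover have "fact (p - m) * pochhammer (real (p - m) + 1) m = fact p"
      using pochhammer_product'[of "1::real" "p - m" m] that by (simp add: pochhammer_fact add.commute)
    ultimately have "pochhammer (real p - real m + 1) m = fact p / fact (p - m)"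
      by (metis fact_nonzero nonzero_mult_div_cancel_left)
    then show ?thesis
      by (simp only: pochhammer_minus)
  qed
  have nz: "\<forall>i\<in>{0..<q}. a \<noteq> - real i" using a by auto
  have "(\<Sum>m | m \<le> p \<and> m \<le> q. 1 / (fact m * fact (p - m) * fact (q - m) * pochhammer a m))
    = (\<Sum>m\<in>{0..q}. (pochhammer (- real p) m * pochhammer (- real q) m) / (fact m * pochhammer a m)) / (fact p * fact q)"
    unfolding sum_divide_distrib
  proof (rule sum.mono_neutral_cong_left)
    \<comment> \<open>For m > p the symbol \<open>pochhammer (- real p) m\<close> contains the
      factor 0, so the sum may run up to q, as in \<open>Vandermonde_pochhammer\<close>.\<close>
    show "\<forall>m\<in>{0..q} - {m. m \<le> p \<and> m \<le> q}. pochhammer (- real p) m * pochhammer (- real q) m / (fact m * pochhammer a m) / (fact p * fact q) = 0"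
      by (auto simp: pochhammer_of_nat_eq_0_iff)
    fix m assume "m \<in> {m. m \<le> p \<and> m \<le> q}"
    then have m: "m \<le> p" "m \<le> q" by auto
    have sq: "(- 1) ^ m * (- 1) ^ m = (1::real)" by (simp flip: power_mult_distrib)
    have "(- 1) ^ m * P * ((- 1) ^ m * Q) = P * Q" for P Q :: real
      using sq by (metis mult.assoc mult.commute mult.left_neutral)
    then show "1 / (fact m * fact (p - m) * fact (q - m) * pochhammer a m) =
        pochhammer (- real p) m * pochhammer (- real q) m / (fact m * pochhammer a m) / (fact p * fact q)"
      by (simp only: c[OF m(1)] c[OF m(2)]) simp
  qed auto
  also have "\<dots> = pochhammer (a + real p) q / pochhammer a q / (fact p * fact q)"
    using Vandermonde_pochhammer[OF nz, of "- real p"] by simp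
  also have "\<dots> = pochhammer a (p + q) / (fact p * pochhammer a p * (fact q * pochhammer a q))"
    using pochhammer_pos[OF a, of p] by (simp add: pochhammer_product')
  finally show ?thesis .
qed

text \<open>Degree n of the product formula with the cosine integrated out: A and B stand for the
  squares of the two points, \<open>4 * A * B\<close> for the square of \<open>2 * x * y\<close>,
  and the quotient of Pochhammer symbols for a moment of order 2m. Collecting the coefficient of
  \<open>A ^ p * B ^ (n - p)\<close> leaves the sum of
  \<open>sum_reciprocal_fact_pochhammer\<close>.\<close>

lemma kingman_moment_identity:
  fixes a A B :: real
  assumes a: "0 < a"
  shows "(\<Sum>m\<le>n div 2. real (n choose (2 * m)) * (A + B) ^ (n - 2 * m) * (4 * A * B) ^ m
            * (pochhammer (1/2) m / pochhammer a m)) / (fact n * pochhammer a n)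
    = (\<Sum>p\<le>n. (A ^ p / (fact p * pochhammer a p)) * (B ^ (n - p) / (fact (n - p) * pochhammer a (n - p))))"
proof -
  define t where "t p m = (A ^ p * B ^ (n - p)) * (1 / (fact m * fact (p - m) * fact (n - p - m) * pochhammer a m))"
    for p m :: nat
  have half: "pochhammer (1/2) m > (0::real)" for m by (rule pochhammer_pos) simp
  have term1: "real (n choose (2 * m)) * (A + B) ^ (n - 2 * m) * (4 * A * B) ^ m * (pochhammer (1/2) m / pochhammer a m)
    = fact n * (\<Sum>i\<le>n - 2 * m. t (m + i) m)" if m: "m \<le> n div 2" for m
  proof -
    \<comment> \<open>\<open>fact_double\<close> splits (2m)! into
      \<open>4 ^ m * pochhammer (1/2) m * fact m\<close>, so the half-integer symbol of the moment
      disappears.\<close>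
    have "real (n choose (2 * m)) * pochhammer (1/2) m * 4 ^ m = fact n / (fact (n - 2 * m) * fact m)"
      using m half[of m] by (simp add: binomial_fact fact_double power_mult)
    moreover have "real (n choose (2 * m)) * (A + B) ^ (n - 2 * m) * (4 * A * B) ^ m * (pochhammer (1/2) m / pochhammer a m)
      = (real (n choose (2 * m)) * pochhammer (1/2) m * 4 ^ m) * (A + B) ^ (n - 2 * m) * ((A * B) ^ m / pochhammer a m)"
      by (simp add: power_mult_distrib)
    ultimately have "real (n choose (2 * m)) * (A + B) ^ (n - 2 * m) * (4 * A * B) ^ m * (pochhammer (1/2) m / pochhammer a m)
      = (fact n / (fact (n - 2 * m) * fact m)) * (A + B) ^ (n - 2 * m) * ((A * B) ^ m / pochhammer a m)"
      by (simp only:)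
    also have "\<dots> = fact n * (\<Sum>i\<le>n - 2 * m. t (m + i) m)"
      unfolding binomial_ring sum_distrib_left sum_distrib_right
    proof (intro sum.cong refl)
      fix i assume i: "i \<in> {..n - 2 * m}"
      have e: "n - (m + i) - m = n - 2 * m - i" "n - (m + i) = m + (n - 2 * m - i)" using m i by auto
      show "fact n / (fact (n - 2 * m) * fact m) * (of_nat (n - 2 * m choose i) * A ^ i * B ^ (n - 2 * m - i)) *
           ((A * B) ^ m / pochhammer a m) = fact n * t (m + i) m"
        using i unfolding t_def e(1) unfolding e(2)
        by (simp add: binomial_fact power_add power_mult_distrib mult_ac)
    qed
    finally show ?thesis .
  qed
  have "(\<Sum>m\<le>n div 2. real (n choose (2 * m)) * (A + B) ^ (n - 2 * m) * (4 * A * B) ^ m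
            * (pochhammer (1/2) m / pochhammer a m)) = fact n * (\<Sum>m\<le>n div 2. \<Sum>i\<le>n - 2 * m. t (m + i) m)"
    unfolding sum_distrib_left by (intro sum.cong refl) (subst term1, auto simp: sum_distrib_left)
  \<comment> \<open>The index p = m + i is the exponent of A; i <= n - 2m becomes m <= p and m <= n
    - p.\<close>
  also have "(\<Sum>m\<le>n div 2. \<Sum>i\<le>n - 2 * m. t (m + i) m) = (\<Sum>p\<le>n. \<Sum>m | m \<le> p \<and> m \<le> n - p. t p m)"
    by (subst (1 2) sum.Sigma, simp, simp, simp, simp,
        rule sum.reindex_bij_witness[of _ "\<lambda>(p, m). (m, p - m)" "\<lambda>(m, i). (m + i, m)"]) auto
  also have "\<dots> = (\<Sum>p\<le>n. (A ^ p * B ^ (n - p)) * (pochhammer a n / (fact p * pochhammer a p * (fact (n - p) * pochhammer a (n - p)))))"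
    unfolding t_def sum_distrib_left[symmetric]
    by (intro sum.cong refl, subst sum_reciprocal_fact_pochhammer[OF a], simp)
  finally show ?thesis
    using pochhammer_pos[OF a, of n] by (simp add: sum_distrib_left sum_divide_distrib mult.assoc)
qed

section \<open>Moments of the kernel and of the Rayleigh distribution\<close>

lemma integrable_kingman_kernel:
  fixes f :: "real \<Rightarrow> real"
  assumes "s \<ge> -1/2" and [measurable]: "f \<in> borel_measurable borel"
    and "\<And>u. u \<in> {-1..1} \<Longrightarrow> \<bar>f u\<bar> \<le> B"
  shows "integrable (kingman_kernel s) f"
proof -
  interpret prob_space "kingman_kernel s" by (rule prob_space_kingman_kernel) fact
  show ?thesis
    by (rule integrable_const_bound[of _ B]) (use AE_kingman_kernel[of s] assms(3) in auto)
qed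

lemma integral_kingman_kernel:
  fixes f :: "real \<Rightarrow> real"
  assumes "s > -1/2" and [measurable]: "f \<in> borel_measurable borel"
  shows "(\<integral>u. f u \<partial>kingman_kernel s) =
    (\<integral>u. indicator {-1..1} u * (Gamma (s + 1) / (sqrt pi * Gamma (s + 1/2)) * (1 - u\<^sup>2) powr (s - 1/2)) * f u \<partial>lborel)"
proof -
  have "Gamma (s + 1) > 0" "Gamma (s + 1/2) > 0" using assms(1) by (auto intro!: Gamma_real_pos)
  then show ?thesis
    using assms by (simp add: kingman_kernel_def integral_density)
qed

lemma integral_kingman_kernel_minus_half:
  fixes f :: "real \<Rightarrow> real"
  assumes [measurable]: "f \<in> borel_measurable borel"
  shows "(\<integral>u. f u \<partial>kingman_kernel (-1/2)) = (f (-1) + f 1) / 2"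
proof -
  have "(\<integral>u. f u \<partial>kingman_kernel (-1/2)) = (\<integral>u. f u \<partial>measure_pmf (pmf_of_set {-1, 1}))"
    by (simp add: kingman_kernel_def integral_distr)
  also have "\<dots> = (f (-1) + f 1) / 2"
    by (subst integral_pmf_of_set) auto
  finally show ?thesis .
qed

lemma integral_kingman_kernel_odd:
  fixes f :: "real \<Rightarrow> real"
  assumes s: "s \<ge> -1/2" and [measurable]: "f \<in> borel_measurable borel"
    and odd: "\<And>u. f (- u) = - f u"
  shows "(\<integral>u. f u \<partial>kingman_kernel s) = 0"
proof (cases "s = -1/2")
  case True
  then show ?thesis
    using integral_kingman_kernel_minus_half[OF assms(2)] odd[of 1] by simp
next
  case False
  then have s': "s > -1/2" using s by simp
  define g where "g u = indicator {-1..1} u * (Gamma (s + 1) / (sqrt pi * Gamma (s + 1/2)) * (1 - u\<^sup>2) powr (s - 1/2)) * f u" for u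
  have "(\<integral>u. g u \<partial>lborel) = (\<integral>u. g (- u) \<partial>lborel)"
    using lborel_integral_real_affine[of "-1" g 0] by simp
  moreover have "g (- u) = - g u" for u
    by (auto simp: g_def odd indicator_def)
  ultimately have "(\<integral>u. g u \<partial>lborel) = 0" by simp
  then show ?thesis
    unfolding integral_kingman_kernel[OF s' assms(2)] g_def .
qed

text \<open>The weight 1 - u^2 raises the exponent of the density by one, which gives the kernel of
  index s + 1; the constant is the quotient of the two normalizations. This drives the induction for
  the even moments.\<close>

lemma integral_kingman_kernel_shift:
  fixes f :: "real \<Rightarrow> real"
  assumes s: "s > -1/2" and [measurable]: "f \<in> borel_measurable borel"
  shows "(\<integral>u. f u * (1 - u\<^sup>2) \<partial>kingman_kernel s) = (s + 1/2) / (s + 1) * (\<integral>u. f u \<partial>kingman_kernel (s + 1))"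
proof -
  let ?c = "\<lambda>s. Gamma (s + 1) / (sqrt pi * Gamma (s + 1/2))"
  have G: "Gamma (s + 1/2) > 0" using s by (auto intro!: Gamma_real_pos)
  have c: "(s + 1/2) / (s + 1) * ?c (s + 1) = ?c s"
  proof -
    have "Gamma (s + 1 + 1) = (s + 1) * Gamma (s + 1)"
      by (rule Gamma_plus1) (use s in \<open>auto dest: nonpos_Ints_nonpos\<close>)
    moreover have "Gamma (s + 1 + 1/2) = Gamma (s + 1/2 + 1)" by (simp add: add.commute)
    moreover have "Gamma (s + 1/2 + 1) = (s + 1/2) * Gamma (s + 1/2)"
      by (rule Gamma_plus1) (use s in \<open>auto dest: nonpos_Ints_nonpos\<close>)
    moreover have "b / d * (d * X / (p * (b * Y))) = X / (p * Y)" if "b \<noteq> 0" "d \<noteq> 0" for b d X Y p :: real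
      using that by simp
    ultimately show ?thesis
      using s by (simp only:)
  qed
  have "(\<integral>u. f u * (1 - u\<^sup>2) \<partial>kingman_kernel s)
     = (\<integral>u. (s + 1/2) / (s + 1) * (indicator {-1..1} u * (?c (s + 1) * (1 - u\<^sup>2) powr (s + 1 - 1/2)) * f u) \<partial>lborel)"
  proof (subst integral_kingman_kernel[OF s], simp, intro Bochner_Integration.integral_cong refl)
    fix u :: real
    show "indicator {-1..1} u * (?c s * (1 - u\<^sup>2) powr (s - 1/2)) * (f u * (1 - u\<^sup>2)) =
      (s + 1/2) / (s + 1) * (indicator {-1..1} u * (?c (s + 1) * (1 - u\<^sup>2) powr (s + 1 - 1/2)) * f u)"
    proof (cases "u \<in> {-1..1}")
      case True
      have mult_rot: "i * (C * P) * (F * q) = C * (i * (P * q) * F)" for i C P F q :: real by simp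
      from True have "u\<^sup>2 \<le> 1" by (simp add: abs_le_iff abs_square_le_1)
      then have "(1 - u\<^sup>2) powr (s - 1/2) * (1 - u\<^sup>2) = (1 - u\<^sup>2) powr (s + 1 - 1/2)"
        using powr_mult_base[of "1 - u\<^sup>2" "s - 1/2"]
        by (simp only: mult.commute[of _ "1 - u\<^sup>2"] diff_ge_0_iff_ge) (simp add: add_diff_eq)
      then have "indicator {-1..1} u * (?c s * (1 - u\<^sup>2) powr (s - 1/2)) * (f u * (1 - u\<^sup>2))
         = ?c s * (indicator {-1..1} u * ((1 - u\<^sup>2) powr (s + 1 - 1/2)) * f u)"
        using mult_rot by metis
      then show ?thesis unfolding c[symmetric] by (simp only: mult.assoc mult.left_commute)
    qed simp
  qed
  also have "\<dots> = (s + 1/2) / (s + 1) * (\<integral>u. f u \<partial>kingman_kernel (s + 1))"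
    using s by (subst integral_kingman_kernel) auto
  finally show ?thesis .
qed

text \<open>Write u^(2m+2) as u^(2m) - u^(2m) (1 - u^2): the second term is a moment of order 2m for
  index s + 1, so the induction on m runs over all s at once. At s = -1/2 the kernel sits on -1 and
  1, and both sides are 1.\<close>

lemma integral_kingman_kernel_even_power:
  assumes s: "s \<ge> -1/2"
  shows "(\<integral>u. u ^ (2 * m) \<partial>kingman_kernel s) = pochhammer (1/2) m / pochhammer (s + 1) m"
proof (cases "s = -1/2")
  case True
  have "pochhammer (1/2) m > (0::real)" by (rule pochhammer_pos) simp
  then show ?thesis
    using True integral_kingman_kernel_minus_half[of "\<lambda>u. u ^ (2 * m)"] by simp
next
  case False
  then have "s > -1/2" using s by simp
  then show ?thesis
  proof (induction m arbitrary: s)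
    case 0
    interpret prob_space "kingman_kernel s" using 0 by (intro prob_space_kingman_kernel) simp
    show ?case using prob_space by simp
  next
    case (Suc m)
    have int: "integrable (kingman_kernel s) (\<lambda>u. u ^ (2 * m))"
      "integrable (kingman_kernel s) (\<lambda>u. u ^ (2 * m) * (1 - u\<^sup>2))"
      using Suc.prems
      by (auto intro!: integrable_kingman_kernel[of s _ 1]
          simp: abs_mult power_abs abs_square_le_1 abs_le_iff power_le_one mult_le_one)
    have "(\<integral>u. u ^ (2 * Suc m) \<partial>kingman_kernel s)
      = (\<integral>u. u ^ (2 * m) - u ^ (2 * m) * (1 - u\<^sup>2) \<partial>kingman_kernel s)"
      by (simp add: algebra_simps power2_eq_square)
    also have "\<dots> = pochhammer (1/2) m / pochhammer (s + 1) m
       - (s + 1/2) / (s + 1) * (pochhammer (1/2) m / pochhammer (s + 2) m)"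
      using Suc.IH[of s] Suc.IH[of "s + 1"] Suc.prems int
      by (simp add: integral_kingman_kernel_shift add.commute add.left_commute)
    also have "\<dots> = pochhammer (1/2) (Suc m) / pochhammer (s + 1) (Suc m)"
    proof -
      have "pochhammer (s + 1) m > 0" using Suc.prems by (intro pochhammer_pos) simp
      moreover have "pochhammer (s + 1) m * (s + 1 + real m) = (s + 1) * pochhammer (s + 2) m"
        using pochhammer_rec[of "s + 1" m] pochhammer_Suc[of "s + 1" m] by (simp add: add.assoc)
      ultimately have *: "(s + 1/2) / (s + 1) * (pochhammer (1/2) m / pochhammer (s + 2) m)
        = (s + 1/2) * pochhammer (1/2) m / (pochhammer (s + 1) m * (s + 1 + real m))"
        by simp
      have "s + 1 + real m \<noteq> 0" using Suc.prems by simp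
      then have "pochhammer (1/2) m / pochhammer (s + 1) m
        = pochhammer (1/2) m * (s + 1 + real m) / (pochhammer (s + 1) m * (s + 1 + real m))"
        by simp
      then show ?thesis
        unfolding * pochhammer_Suc diff_divide_distrib[symmetric]
        by (simp only: diff_divide_distrib[symmetric]) (simp add: algebra_simps)
    qed
    finally show ?case .
  qed
qed

text \<open>The substitution t = a x^2 with a = s + 1 turns the integral into Gamma (a + n), and
  Gamma (a + n) / Gamma a is the Pochhammer symbol. The case n = 0 is the total mass, the case n = 1
  the second moment 1.\<close>

lemma nn_integral_rayleigh_power:
  assumes s: "s \<ge> -1/2"
  shows "(\<integral>\<^sup>+ x. ennreal (x ^ (2 * n)) \<partial>rayleigh s) = ennreal (pochhammer (s + 1) n / (s + 1) ^ n)"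
proof -
  define a where "a = s + 1"
  have a: "a > 0" using s by (simp add: a_def)
  have G: "Gamma a > 0" using a by (intro Gamma_real_pos)
  let ?f = "\<lambda>t. t powr (a + real n - 1) * exp (- t)"
  have fG: "(?f has_integral Gamma (a + real n)) {0..}"
    using Gamma_integral_real[of "a + real n"] a by (simp add: exp_minus divide_inverse)
  \<comment> \<open>Removing the point 0 matches the set on which the Rayleigh density is positive
    and changes no integral.\<close>
  have "negligible {x \<in> {0::real..} - {0<..}. ?f x \<noteq> 0}" "negligible {x \<in> {0<..} - {0::real..}. ?f x \<noteq> 0}"
    by (rule negligible_subset[of "{0}"]; auto)+
  then have fG: "(?f has_integral Gamma (a + real n)) {0<..}"
    using fG by (simp only: has_integral_spike_set_eq[of "{0..}" "{0<..}" ?f])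
  have f: "?f absolutely_integrable_on {0<..}" "integral {0<..} ?f = Gamma (a + real n)"
    using fG by (auto intro!: nonnegative_absolutely_integrable_1 simp: has_integral_integrable integral_unique)
  have img: "(\<lambda>x. a * x\<^sup>2) ` {0<..} = {0<..}"
  proof (intro equalityI subsetI)
    fix y :: real assume "y \<in> {0<..}"
    then have "y = a * (sqrt (y / a))\<^sup>2" "sqrt (y / a) > 0" using a by auto
    then show "y \<in> (\<lambda>x. a * x\<^sup>2) ` {0<..}" by (metis greaterThan_iff imageI)
  qed (use a in auto)
  have inj: "inj_on (\<lambda>x. a * x\<^sup>2) {0<..}"
    using a by (auto simp: inj_on_def)
  have "(\<lambda>x. \<bar>2 * a * x\<bar> * ?f (a * x\<^sup>2)) absolutely_integrable_on {0<..} \<and>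
     integral {0<..} (\<lambda>x. \<bar>2 * a * x\<bar> * ?f (a * x\<^sup>2)) = Gamma (a + real n)"
  proof (subst has_absolute_integral_change_of_variables_1'[OF _ _ inj])
    show "((\<lambda>x. a * x\<^sup>2) has_real_derivative 2 * a * x) (at x within {0<..})" for x
      by (auto intro!: derivative_eq_intros)
  qed (use f in \<open>simp_all add: img\<close>)
  then have hi: "((\<lambda>x. \<bar>2 * a * x\<bar> * ?f (a * x\<^sup>2)) has_integral Gamma (a + real n)) {0<..}"
    by (auto simp: has_integral_iff intro: set_lebesgue_integral_eq_integral(1))
  have nn: "(\<integral>\<^sup>+ x. ennreal (\<bar>2 * a * x\<bar> * ?f (a * x\<^sup>2)) * indicator {0<..} x \<partial>lborel) = ennreal (Gamma (a + real n))"
    using nn_integral_has_integral_lebesgue'[OF _ hi] by simp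
  \<comment> \<open>The prefactor compares 2 a^(a+n) x^(2a+2n-1), produced by the substitution, with
    the density times \<open>x ^ (2 * n)\<close>.\<close>
  have "(\<integral>\<^sup>+ x. ennreal (x ^ (2 * n)) \<partial>rayleigh s) =
     (\<integral>\<^sup>+ x. ennreal (1 / (Gamma a * a ^ n)) * (ennreal (\<bar>2 * a * x\<bar> * ?f (a * x\<^sup>2)) * indicator {0<..} x) \<partial>lborel)"
    unfolding rayleigh_def
  proof (subst nn_integral_density, simp, simp, intro nn_integral_cong)
    fix x :: real
    show "ennreal (if 0 < x then 2 * (s + 1) powr (s + 1) / Gamma (s + 1) * x powr (2 * s + 1) * exp (- (s + 1) * x\<^sup>2) else 0)
           * ennreal (x ^ (2 * n))
       = ennreal (1 / (Gamma a * a ^ n)) * (ennreal (\<bar>2 * a * x\<bar> * ?f (a * x\<^sup>2)) * indicator {0<..} x)"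
    proof (cases "x > 0")
      case True
      have "\<bar>2 * a * x\<bar> * (a * x\<^sup>2) powr (a + real n - 1) = 2 * a powr a * a ^ n * (x powr (2 * s + 1) * x ^ (2 * n))"
      proof -
        have "(a * x\<^sup>2) powr (a + real n - 1) = a powr (a + real n - 1) * x powr (2 * (a + real n - 1))"
          using True a by (simp add: powr_mult powr_powr flip: powr_numeral)
        moreover have "a * a powr (a + real n - 1) = a powr a * a ^ n"
          using a by (simp add: powr_mult_base powr_add powr_realpow)
        moreover have "x * x powr (2 * (a + real n - 1)) = x powr (2 * s + 1) * x ^ (2 * n)"
          using True by (simp add: powr_mult_base a_def flip: powr_realpow powr_add) (simp add: add_ac)
        moreover have "\<bar>2 * a * x\<bar> * (Q * R) = 2 * (a * Q) * (x * R)" for Q R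
          using True a by (simp add: abs_mult)
        ultimately show ?thesis by (simp only:)
      qed
      then have "1 / (Gamma a * a ^ n) * (\<bar>2 * a * x\<bar> * ?f (a * x\<^sup>2)) =
         2 * a powr a / Gamma a * x powr (2 * s + 1) * exp (- a * x\<^sup>2) * x ^ (2 * n)"
        using a by (simp add: mult.assoc[symmetric])
      then show ?thesis using True a G
        by (simp add: a_def[symmetric] flip: ennreal_mult'')
    qed simp
  qed
  also have "\<dots> = ennreal (1 / (Gamma a * a ^ n)) * ennreal (Gamma (a + real n))"
    by (subst nn_integral_cmult) (simp_all only: nn, measurable)
  also have "\<dots> = ennreal (pochhammer a n / a ^ n)"
    using a G by (subst pochhammer_Gamma) (auto simp flip: ennreal_mult' dest: nonpos_Ints_nonpos)
  finally show ?thesis by (simp add: a_def)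
qed

section \<open>Factors of an exponential\<close>

text \<open>Schwarz's lemma for \<open>g / (2 * A - g)\<close>, where \<open>A\<close> bounds the real part of \<open>g\<close>, turns the one-sided bound into a bound on the modulus.\<close>

lemma entire_linear_Re_bound_imp_linear:
  fixes g :: "complex \<Rightarrow> complex"
  assumes g: "g holomorphic_on UNIV" and g0: "g 0 = 0" and c: "0 \<le> c"
    and Re: "\<And>z. Re (g z) \<le> c * norm z"
  shows "g z = deriv g 0 * z"
proof -
  have bound: "norm (g z) \<le> (4 * c + 2) * norm z ^ 1" if z: "1 \<le> norm z" for z
  proof -
    have z0: "z \<noteq> 0" using z by auto
    \<comment> \<open>Twice \<open>norm z\<close>, so that z corresponds to a point of norm 1/2 in
      the unit disc: Schwarz then gives norm (g z) <= norm (2A - g z) / 2, which solves to norm (g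
      z) <= 2A.\<close>
    define R where "R = 2 * norm z"
    \<comment> \<open>The summand 1 makes A positive and the bound Re g < A strict even for c =
      0.\<close>
    define A where "A = c * R + 1"
    have R: "R > 0" using z unfolding R_def by linarith
    have A: "A > 0" using c R by (simp add: A_def add_nonneg_pos)
    define f where "f = (\<lambda>w. g (of_real R * w) / (2 * of_real A - g (of_real R * w)))"
    have less: "Re (g (of_real R * w)) < A" if "norm w < 1" for w
    proof -
      have "Re (g (of_real R * w)) \<le> c * (R * norm w)"
        using Re[of "of_real R * w"] R by (simp add: norm_mult)
      also have "\<dots> \<le> c * (R * 1)"
        using c R that by (intro mult_left_mono) auto
      finally show ?thesis by (simp add: A_def)
    qed
    have nz: "2 * of_real A - g (of_real R * w) \<noteq> 0" if "norm w < 1" for w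
    proof
      assume "2 * of_real A - g (of_real R * w) = 0"
      then have "Re (2 * of_real A - g (of_real R * w)) = 0" by simp
      then show False using less[OF that] A by simp
    qed
    have gR: "(\<lambda>w. g (of_real R * w)) holomorphic_on ball 0 1"
      by (rule holomorphic_on_compose_gen[OF _ g, unfolded o_def]) (auto intro!: holomorphic_intros)
    have "f holomorphic_on ball 0 1"
      unfolding f_def using nz by (intro holomorphic_intros gR) (auto simp: dist_norm)
    moreover have "f 0 = 0" by (simp add: f_def g0)
    moreover have "norm (f w) < 1" if w: "norm w < 1" for w
    proof -
      let ?v = "g (of_real R * w)"
      have "norm ?v < norm (2 * of_real A - ?v)"
      proof -
        \<comment> \<open>This is the difference of the squared moduli of 2A - v and v: the points
          with real part below A are those nearer to 0 than to 2A.\<close>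
        have "0 < 4 * A * (A - Re ?v)" using A less[OF w] by simp
        then have "(Re ?v)\<^sup>2 + (Im ?v)\<^sup>2 < (2 * A - Re ?v)\<^sup>2 + (Im ?v)\<^sup>2"
          by (simp add: power2_eq_square algebra_simps)
        then show ?thesis unfolding norm_complex_def by simp
      qed
      then show ?thesis using nz[OF w] by (simp add: f_def norm_divide)
    qed
    moreover have \<xi>: "norm (z / of_real R) < 1" using R z0 by (simp add: R_def norm_divide)
    ultimately have "norm (f (z / of_real R)) \<le> norm (z / of_real R)"
      by (rule Schwarz_Lemma(1))
    also have "norm (z / of_real R) = 1 / 2" using z0 by (simp add: R_def norm_divide)
    also have "f (z / of_real R) = g z / (2 * of_real A - g z)" using R by (simp add: f_def)
    finally have "norm (g z) \<le> norm (2 * of_real A - g z) / 2"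
      using nz[OF \<xi>] R by (simp add: norm_divide field_simps)
    also have "\<dots> \<le> (2 * A + norm (g z)) / 2"
      using norm_triangle_ineq4[of "2 * of_real A" "g z"] A by (simp add: norm_mult)
    finally have "norm (g z) \<le> 2 * A" by simp
    also have "\<dots> \<le> (4 * c + 2) * norm z" using z by (simp add: A_def R_def algebra_simps)
    finally show ?thesis by simp
  qed
  \<comment> \<open>Linear growth outside the unit disc leaves only the Taylor terms of degree 0 and
    1.\<close>
  show ?thesis
    using Liouville_polynomial[OF g bound, where \<xi> = z] by (simp add: g0)
qed

text \<open>Without zeros f has an entire logarithm. The growth bound controls only its real part,
  which is what \<open>entire_linear_Re_bound_imp_linear\<close> accepts.\<close>

lemma entire_factor_of_exp:
  fixes f h :: "complex \<Rightarrow> complex"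
  assumes f: "f holomorphic_on UNIV" and f0: "f 0 = 1" and c: "0 \<le> c"
    and nz: "\<And>z. f z \<noteq> 0" and bound: "\<And>z. norm (f z) \<le> exp (c * norm z)"
  shows "f z = exp (deriv f 0 * z)"
proof -
  obtain l where l: "l holomorphic_on UNIV" "\<And>z. f z = exp (l z)"
    using contractible_imp_holomorphic_log[OF f _ nz] by auto
  \<comment> \<open>Since f 0 = 1, also exp (l 0) = 1, so subtracting \<open>l 0\<close> keeps the
    exponential and normalizes g at 0.\<close>
  define g where "g = (\<lambda>z. l z - l 0)"
  have g: "g holomorphic_on UNIV" unfolding g_def by (intro holomorphic_intros l)
  have fg: "f z = exp (g z)" for z
    using l(2)[of z] l(2)[of 0] f0 by (simp add: g_def exp_diff)
  have "Re (g z) \<le> c * norm z" for z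
    using bound[of z] by (simp add: fg)
  then have lin: "g z = deriv g 0 * z" for z
    by (intro entire_linear_Re_bound_imp_linear[OF g _ c]) (auto simp: g_def)
  have "(f has_field_derivative deriv g 0) (at 0)"
    unfolding fg[abs_def] by (subst lin[abs_def]) (auto intro!: derivative_eq_intros)
  then have "deriv f 0 = deriv g 0" by (rule DERIV_imp_deriv)
  then show ?thesis using fg[of z] lin[of z] by simp
qed

text \<open>A form of Raikov's theorem. Nonnegativity of the coefficients bounds the modulus of a
  factor on a circle by its value on the positive axis.\<close>

lemma nonneg_power_series_factor_of_exp:
  fixes p q :: "nat \<Rightarrow> real"
  assumes nonneg: "\<And>n. 0 \<le> p n" "\<And>n. 0 \<le> q n" and one: "p 0 = 1" "q 0 = 1" and c: "0 \<le> c"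
    and sum: "\<And>z. summable (\<lambda>n. p n * z ^ n)" "\<And>z. summable (\<lambda>n. q n * z ^ n)"
    and prod: "\<And>r. 0 \<le> r \<Longrightarrow> (\<Sum>n. p n * r ^ n) * (\<Sum>n. q n * r ^ n) = exp (c * r)"
  shows "(\<Sum>n. p n * z ^ n) = exp (p 1 * z)"
proof -
  define F where "F a z = (\<Sum>n. complex_of_real (a n) * z ^ n)" for a z
  have norm_sum: "summable (\<lambda>n. norm (complex_of_real (a n) * z ^ n))"
    if "\<And>n. 0 \<le> a n" "\<And>z. summable (\<lambda>n. a n * z ^ n)" for a :: "nat \<Rightarrow> real" and z
    using that(2)[of "norm z"] that(1) by (simp add: norm_mult norm_power)
  have der: "(F a has_field_derivative (\<Sum>n. diffs (\<lambda>n. complex_of_real (a n)) n * z ^ n)) (at z)"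
    if "\<And>n. 0 \<le> a n" "\<And>z. summable (\<lambda>n. a n * z ^ n)" for a :: "nat \<Rightarrow> real" and z
    unfolding F_def[abs_def]
    by (rule termdiffs_strong_converges_everywhere[OF summable_norm_cancel[OF norm_sum[OF that]]])
  have hol: "F p holomorphic_on UNIV" "F q holomorphic_on UNIV"
    using der[OF nonneg(1) sum(1)] der[OF nonneg(2) sum(2)]
    by (auto simp: holomorphic_on_def field_differentiable_def intro: has_field_derivative_at_within)
  have F_real: "F a (of_real x) = of_real (\<Sum>n. a n * x ^ n)"
    if "\<And>z. summable (\<lambda>n. a n * z ^ n)" for a :: "nat \<Rightarrow> real" and x
    unfolding F_def using suminf_of_real[OF that[of x], where 'a = complex] by simp
  have F_norm: "norm (F a z) \<le> (\<Sum>n. a n * norm z ^ n)"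
    if "\<And>n. 0 \<le> a n" "\<And>z. summable (\<lambda>n. a n * z ^ n)" for a :: "nat \<Rightarrow> real" and z
    unfolding F_def using summable_norm[OF norm_sum[OF that, of z]] that(1)
    by (simp add: norm_mult norm_power)
  \<comment> \<open>The identity is given on the half-line only; its points accumulate at 0, so it
    extends to the plane and shows that \<open>F p\<close> has no zeros.\<close>
  have "F p z * F q z - exp (of_real c * z) = 0" for z
  proof (rule analytic_continuation[where S = UNIV and U = "complex_of_real ` {0..}" and \<xi> = 0
        and f = "\<lambda>z. F p z * F q z - exp (of_real c * z)"])
    show "0 islimpt complex_of_real ` {0..}"
      unfolding islimpt_approachable
    proof safe
      fix e :: real assume "e > 0"
      then have "complex_of_real (e/2) \<in> complex_of_real ` {0..} \<and> complex_of_real (e/2) \<noteq> 0 \<and> dist (complex_of_real (e/2)) 0 < e"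
        using imageI[of "e/2" "{0..}" complex_of_real] by simp
      then show "\<exists>x'\<in>complex_of_real ` {0..}. x' \<noteq> 0 \<and> dist x' 0 < e" by blast
    qed
    fix z assume "z \<in> complex_of_real ` {0..}"
    then obtain r where r: "0 \<le> r" "z = of_real r" by auto
    have "F p z * F q z = of_real (exp (c * r))"
      unfolding r(2) F_real[OF sum(1)] F_real[OF sum(2)] prod[OF r(1), symmetric] by simp
    then show "F p z * F q z - exp (of_real c * z) = 0"
      by (simp add: r(2) exp_of_real flip: of_real_mult)
  qed (auto intro!: holomorphic_intros hol)
  then have nz: "F p z \<noteq> 0" for z by (metis exp_not_eq_zero eq_iff_diff_eq_0 mult_zero_left)
  have "norm (F p z) \<le> exp (c * norm z)" for z
  proof -
    \<comment> \<open>On the positive axis the series of q is at least its constant term 1, so that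
      of p is at most the product.\<close>
    have "(\<Sum>n\<in>{0}. q n * norm z ^ n) \<le> (\<Sum>n. q n * norm z ^ n)"
      by (rule sum_le_suminf[OF sum(2)]) (auto simp: nonneg)
    moreover have "0 \<le> (\<Sum>n. p n * norm z ^ n)"
      by (rule suminf_nonneg[OF sum(1)]) (auto simp: nonneg)
    ultimately have "(\<Sum>n. p n * norm z ^ n) * 1 \<le> exp (c * norm z)"
      unfolding prod[OF norm_ge_zero, symmetric] by (intro mult_left_mono) (auto simp: one)
    then show ?thesis using F_norm[OF nonneg(1) sum(1), of z] by simp
  qed
  moreover have "deriv (F p) 0 = of_real (p 1)"
    using DERIV_imp_deriv[OF der[OF nonneg(1) sum(1), of 0]] by (simp add: diffs_def)
  moreover have "F p 0 = 1" by (simp add: F_def one)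
  ultimately have "F p (of_real z) = exp (of_real (p 1) * of_real z)"
    using entire_factor_of_exp[OF hol(1) _ c nz, of "of_real z"] by simp
  then have "complex_of_real (\<Sum>n. p n * z ^ n) = of_real (exp (p 1 * z))"
    unfolding F_real[OF sum(1)] by (simp add: exp_of_real flip: of_real_mult)
  then show ?thesis by (simp only: of_real_eq_iff)
qed

text \<open>Finiteness at r >= 0 justifies termwise integration for every real z, also negative: the
  coefficients being nonnegative, the absolute values of the terms sum to the series at |z|, whose
  integral is finite.\<close>

lemma integral_nonneg_power_series:
  fixes p :: "nat \<Rightarrow> 'a \<Rightarrow> real"
  assumes [measurable]: "\<And>n. p n \<in> borel_measurable M" and nonneg: "\<And>n x. 0 \<le> p n x"
    and sums: "\<And>x z. (\<lambda>n. p n x * z ^ n) sums f x z"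
    and finite: "\<And>r. 0 \<le> r \<Longrightarrow> (\<integral>\<^sup>+ x. ennreal (f x r) \<partial>M) < \<infinity>"
  shows "integrable M (p n)" and "(\<lambda>n. (\<integral>x. p n x \<partial>M) * z ^ n) sums (\<integral>x. f x z \<partial>M)"
proof -
  have f_eq: "f x z = (\<Sum>n. p n x * z ^ n)" for x z using sums by (rule sums_unique)
  have le: "p n x * r ^ n \<le> f x r" if "0 \<le> r" for n x r
  proof -
    have "(\<Sum>i\<in>{n}. p i x * r ^ i) \<le> (\<Sum>i. p i x * r ^ i)"
      by (rule sum_le_suminf[OF sums_summable[OF sums]]) (use nonneg that in auto)
    then show ?thesis by (simp add: f_eq)
  qed
  show int: "integrable M (p n)" for n
  proof (rule integrableI_nonneg)
    have "(\<integral>\<^sup>+ x. ennreal (p n x) \<partial>M) \<le> (\<integral>\<^sup>+ x. ennreal (f x 1) \<partial>M)"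
      using le[of 1 n] by (intro nn_integral_mono ennreal_leI) auto
    then show "(\<integral>\<^sup>+ x. ennreal (p n x) \<partial>M) < \<infinity>" using finite[of 1] by (rule order.strict_trans1) simp
  qed (use nonneg in auto)
  have E: "(\<Sum>n. ennreal ((\<integral>x. p n x \<partial>M) * \<bar>z\<bar> ^ n)) = (\<integral>\<^sup>+ x. ennreal (f x \<bar>z\<bar>) \<partial>M)"
  proof -
    have "ennreal (f x \<bar>z\<bar>) = (\<Sum>n. ennreal (p n x * \<bar>z\<bar> ^ n))" for x
      unfolding f_eq by (rule suminf_ennreal_eq[symmetric]) (use nonneg sums[of x "\<bar>z\<bar>"] in \<open>auto simp: f_eq\<close>)
    then have "(\<integral>\<^sup>+ x. ennreal (f x \<bar>z\<bar>) \<partial>M) = (\<Sum>n. \<integral>\<^sup>+ x. ennreal (p n x * \<bar>z\<bar> ^ n) \<partial>M)"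
      by (simp add: nn_integral_suminf)
    also have "\<dots> = (\<Sum>n. ennreal ((\<integral>x. p n x \<partial>M) * \<bar>z\<bar> ^ n))"
      using int nonneg by (subst nn_integral_eq_integral) auto
    finally show ?thesis by simp
  qed
  have "summable (\<lambda>n. (\<integral>x. p n x \<partial>M) * \<bar>z\<bar> ^ n)"
    by (rule summable_suminf_not_top) (use finite[of "\<bar>z\<bar>"] E nonneg in auto)
  then have "(\<lambda>n. \<integral>x. p n x * z ^ n \<partial>M) sums (\<integral>x. (\<Sum>n. p n x * z ^ n) \<partial>M)"
    using nonneg int sums_summable[OF sums[of _ "\<bar>z\<bar>"]]
    by (intro sums_integral) (auto simp: abs_mult power_abs)
  then show "(\<lambda>n. (\<integral>x. p n x \<partial>M) * z ^ n) sums (\<integral>x. f x z \<partial>M)"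
    by (simp add: f_eq)
qed

section \<open>The product formula\<close>

text \<open>Odd moments of the cosine vanish, so only even powers of 2xy survive the binomial
  expansion, and \<open>kingman_moment_identity\<close> applies to the squares of x and y.\<close>

lemma integral_kingman_kernel_binomial:
  assumes s: "s \<ge> -1/2"
  shows "(\<integral>u. (x\<^sup>2 + 2 * u * x * y + y\<^sup>2) ^ n \<partial>kingman_kernel s) / (fact n * pochhammer (s + 1) n)
    = (\<Sum>p\<le>n. ((x\<^sup>2) ^ p / (fact p * pochhammer (s + 1) p))
         * ((y\<^sup>2) ^ (n - p) / (fact (n - p) * pochhammer (s + 1) (n - p))))"
proof -
  define t where "t k = real (n choose k) * (x\<^sup>2 + y\<^sup>2) ^ (n - k) * (2 * x * y) ^ k" for k
  have int: "integrable (kingman_kernel s) (\<lambda>u. u ^ k)" for k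
    by (rule integrable_kingman_kernel[OF s, of _ 1]) (auto simp: power_abs power_le_one_iff abs_le_iff)
  have odd: "(\<integral>u. u ^ k \<partial>kingman_kernel s) = 0" if "odd k" for k
    using that by (intro integral_kingman_kernel_odd[OF s]) auto
  have "(x\<^sup>2 + 2 * u * x * y + y\<^sup>2) ^ n = (\<Sum>k\<le>n. t k * u ^ k)" for u
  proof -
    have "(x\<^sup>2 + 2 * u * x * y + y\<^sup>2) ^ n = ((2 * x * y) * u + (x\<^sup>2 + y\<^sup>2)) ^ n"
      by (simp add: algebra_simps)
    then show ?thesis
      unfolding binomial_ring t_def by (simp add: power_mult_distrib mult_ac)
  qed
  then have "(\<integral>u. (x\<^sup>2 + 2 * u * x * y + y\<^sup>2) ^ n \<partial>kingman_kernel s)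
     = (\<Sum>k\<le>n. t k * (\<integral>u. u ^ k \<partial>kingman_kernel s))"
    using int by simp
  also have "\<dots> = (\<Sum>k\<in>(*) 2 ` {..n div 2}. t k * (\<integral>u. u ^ k \<partial>kingman_kernel s))"
  proof (rule sum.mono_neutral_right)
    show "\<forall>k\<in>{..n} - (*) 2 ` {..n div 2}. t k * (\<integral>u. u ^ k \<partial>kingman_kernel s) = 0"
    proof
      fix k assume k: "k \<in> {..n} - (*) 2 ` {..n div 2}"
      have "odd k"
      proof
        assume "even k"
        then obtain m where "k = 2 * m" by (elim evenE)
        then show False using k by auto
      qed
      then show "t k * (\<integral>u. u ^ k \<partial>kingman_kernel s) = 0" by (simp add: odd)
    qed
  qed auto
  also have "\<dots> = (\<Sum>m\<le>n div 2. t (2 * m) * (pochhammer (1/2) m / pochhammer (s + 1) m))"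
    by (subst sum.reindex) (auto simp: inj_on_def integral_kingman_kernel_even_power[OF s])
  also have "\<dots> = (\<Sum>m\<le>n div 2. real (n choose (2 * m)) * (x\<^sup>2 + y\<^sup>2) ^ (n - 2 * m) * (4 * x\<^sup>2 * y\<^sup>2) ^ m
            * (pochhammer (1/2) m / pochhammer (s + 1) m))"
    unfolding t_def by (simp add: power_mult power_mult_distrib)
  finally show ?thesis
    using kingman_moment_identity[of "s + 1" n "x\<^sup>2" "y\<^sup>2"] s by simp
qed

text \<open>Gegenbauer's product formula for Bessel functions, at imaginary arguments, where all
  terms are nonnegative. By \<open>integral_kingman_kernel_binomial\<close> each degree of the
  integrated series is that degree of a Cauchy product.\<close>

lemma nn_integral_kingman_kernel_bessel_clifford:
  assumes s: "s \<ge> -1/2"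
  shows "(\<integral>\<^sup>+ u. ennreal (bessel_clifford (s + 1) (x\<^sup>2 + 2 * u * x * y + y\<^sup>2)) \<partial>kingman_kernel s)
    = ennreal (bessel_clifford (s + 1) (x\<^sup>2) * bessel_clifford (s + 1) (y\<^sup>2))"
proof -
  define a where "a = s + 1"
  have a: "0 < a" using s by (simp add: a_def)
  note poch = pochhammer_pos[OF a]
  define h where "h n z = z ^ n / (fact n * pochhammer a n)" for n and z :: real
  have h_nonneg: "0 \<le> h n z" if "0 \<le> z" for n z
    using that poch[of n] by (simp add: h_def)
  have h_sums: "(\<lambda>n. h n z) sums bessel_clifford a z" for z
    unfolding h_def by (rule bessel_clifford_sums[OF a])
  have [measurable]: "h n \<in> borel_measurable borel" for n
    unfolding h_def[abs_def] by measurable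
  define q where "q u = x\<^sup>2 + 2 * u * x * y + y\<^sup>2" for u
  have [measurable]: "q \<in> borel_measurable borel" unfolding q_def[abs_def] by measurable
  \<comment> \<open>The radicand, and with it every term of the series, is nonnegative only on
    [-1, 1], where the kernel is concentrated.\<close>
  have AEq: "AE u in kingman_kernel s. 0 \<le> q u"
    using AE_kingman_kernel[of s] kingman_radicand_nonneg by (auto simp: q_def)
  have suminf_eq: "ennreal (bessel_clifford a z) = (\<Sum>n. ennreal (h n z))" if "0 \<le> z" for z
    by (rule suminf_ennreal_eq[symmetric]) (use h_nonneg[OF that] h_sums in auto)
  have int: "integrable (kingman_kernel s) (\<lambda>u. h n (q u))" for n
  proof -
    have "continuous_on {-1..1} (\<lambda>u. h n (q u))"
      unfolding h_def q_def using poch[of n] by (intro continuous_intros) auto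
    then have "bounded ((\<lambda>u. h n (q u)) ` {-1..1})"
      by (intro compact_imp_bounded compact_continuous_image) auto
    then obtain B where "\<forall>v\<in>(\<lambda>u. h n (q u)) ` {-1..1}. norm v \<le> B"
      unfolding bounded_iff by blast
    then show ?thesis by (intro integrable_kingman_kernel[OF s, of _ B]) auto
  qed
  have "(\<integral>\<^sup>+ u. ennreal (bessel_clifford a (q u)) \<partial>kingman_kernel s) = (\<integral>\<^sup>+ u. (\<Sum>n. ennreal (h n (q u))) \<partial>kingman_kernel s)"
    by (rule nn_integral_cong_AE) (use AEq in \<open>auto simp: suminf_eq\<close>)
  also have "\<dots> = (\<Sum>n. \<integral>\<^sup>+ u. ennreal (h n (q u)) \<partial>kingman_kernel s)"
    by (rule nn_integral_suminf) measurable
  also have "\<dots> = (\<Sum>n. ennreal (\<Sum>p\<le>n. h p (x\<^sup>2) * h (n - p) (y\<^sup>2)))"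
  proof (rule suminf_cong)
    fix n
    have "AE u in kingman_kernel s. 0 \<le> h n (q u)"
      using AEq by eventually_elim (rule h_nonneg)
    then have "(\<integral>\<^sup>+ u. ennreal (h n (q u)) \<partial>kingman_kernel s) = ennreal (\<integral>u. h n (q u) \<partial>kingman_kernel s)"
      by (rule nn_integral_eq_integral[OF int])
    also have "(\<integral>u. h n (q u) \<partial>kingman_kernel s) = (\<Sum>p\<le>n. h p (x\<^sup>2) * h (n - p) (y\<^sup>2))"
      unfolding h_def q_def a_def integral_kingman_kernel_binomial[OF s, symmetric] by simp
    finally show "(\<integral>\<^sup>+ u. ennreal (h n (q u)) \<partial>kingman_kernel s) = ennreal (\<Sum>p\<le>n. h p (x\<^sup>2) * h (n - p) (y\<^sup>2))" .
  qed
  also have "\<dots> = ennreal (bessel_clifford a (x\<^sup>2) * bessel_clifford a (y\<^sup>2))"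
  proof (rule suminf_ennreal_eq)
    have "summable (\<lambda>n. norm (h n z))" for z
      unfolding h_def real_norm_def by (rule summable_bessel_clifford[OF a])
    then show "(\<lambda>n. \<Sum>p\<le>n. h p (x\<^sup>2) * h (n - p) (y\<^sup>2)) sums (bessel_clifford a (x\<^sup>2) * bessel_clifford a (y\<^sup>2))"
      using Cauchy_product_sums[of "\<lambda>n. h n (x\<^sup>2)" "\<lambda>n. h n (y\<^sup>2)"] h_sums[THEN sums_unique] by simp
  qed (auto intro!: sum_nonneg mult_nonneg_nonneg h_nonneg)
  finally show ?thesis by (simp add: a_def q_def)
qed

text \<open>The bound comes from Poisson's integral \<open>bessel_clifford (s + 1) (- (x / 2)\<^sup>2) = \<integral>u. cos (u * x)\<close>
  against the kernel.\<close>

lemma abs_bessel_clifford_le_1: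
  assumes s: "s \<ge> -1/2" and z: "z \<le> 0"
  shows "\<bar>bessel_clifford (s + 1) z\<bar> \<le> 1"
proof -
  interpret prob_space "kingman_kernel s" by (rule prob_space_kingman_kernel[OF s])
  \<comment> \<open>Chosen so that z = - (x / 2)^2 in Poisson's integral.\<close>
  define x where "x = 2 * sqrt (- z)"
  have x2: "x\<^sup>2 = - 4 * z" using z by (simp add: x_def power_mult_distrib)
  define c where "c n u = (- 1) ^ n / fact (2 * n) * (u * x) ^ (2 * n)" for n and u :: real
  have c_abs: "\<bar>c n u\<bar> \<le> \<bar>x\<bar> ^ (2 * n) / fact (2 * n)" if "u \<in> {-1..1}" for n u
    using that power_mono[of "\<bar>u * x\<bar>" "\<bar>x\<bar>" "2 * n"] mult_mono[of "\<bar>u\<bar>" 1 "\<bar>x\<bar>" "\<bar>x\<bar>"]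
    by (auto simp: c_def abs_mult power_abs divide_right_mono abs_le_iff)
  have cos: "(\<lambda>n. c n u) sums cos (u * x)" for u
    using cos_paired[of "u * x"] by (simp add: c_def)
  have sum: "summable (\<lambda>n. \<bar>x\<bar> ^ (2 * n) / fact (2 * n))"
  proof (rule summable_comparison_test'[OF summable_exp[of "x\<^sup>2"]])
    fix n :: nat
    have "(fact n :: real) \<le> fact (2 * n)" by (rule fact_mono) simp
    then have "(x\<^sup>2) ^ n / fact (2 * n) \<le> (x\<^sup>2) ^ n / fact n"
      by (intro divide_left_mono) auto
    moreover have "\<bar>x\<bar> ^ (2 * n) = (x\<^sup>2) ^ n" by (simp only: power_mult power2_abs)
    ultimately show "norm (\<bar>x\<bar> ^ (2 * n) / fact (2 * n)) \<le> inverse (fact n) * (x\<^sup>2) ^ n"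
      by (simp add: divide_inverse mult.commute)
  qed
  have [measurable]: "c n \<in> borel_measurable borel" for n unfolding c_def[abs_def] by measurable
  have int: "integrable (kingman_kernel s) (c n)" for n
    by (rule integrable_kingman_kernel[OF s _ c_abs]) auto
  have "(\<lambda>n. \<integral>u. c n u \<partial>kingman_kernel s) sums (\<integral>u. (\<Sum>n. c n u) \<partial>kingman_kernel s)"
  proof (rule sums_integral[OF int])
    show "AE u in kingman_kernel s. summable (\<lambda>n. norm (c n u))"
      using AE_kingman_kernel[of s]
    proof eventually_elim
      case (elim u)
      show ?case by (rule summable_comparison_test'[OF sum]) (use c_abs[OF elim] in auto)
    qed
    have "norm (\<integral>u. norm (c n u) \<partial>kingman_kernel s) \<le> \<bar>x\<bar> ^ (2 * n) / fact (2 * n)" for n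
    proof -
      have "(\<integral>u. norm (c n u) \<partial>kingman_kernel s) \<le> (\<integral>u. \<bar>x\<bar> ^ (2 * n) / fact (2 * n) \<partial>kingman_kernel s)"
        using AE_kingman_kernel[of s] c_abs int by (intro integral_mono_AE) auto
      then show ?thesis by (simp add: prob_space)
    qed
    then show "summable (\<lambda>n. \<integral>u. norm (c n u) \<partial>kingman_kernel s)"
      by (intro summable_comparison_test'[OF sum])
  qed
  moreover have "(\<integral>u. c n u \<partial>kingman_kernel s) = z ^ n / (fact n * pochhammer (s + 1) n)" for n
  proof -
    have half: "pochhammer (1/2) n > (0::real)" by (rule pochhammer_pos) simp
    have "(\<integral>u. c n u \<partial>kingman_kernel s) = (- 1) ^ n / fact (2 * n) * (x\<^sup>2) ^ n * (pochhammer (1/2) n / pochhammer (s + 1) n)"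
      unfolding c_def using integral_kingman_kernel_even_power[OF s, of n]
      by (simp add: power_mult_distrib mult_ac flip: power_mult)
    also have "(x\<^sup>2) ^ n = (- 1) ^ n * 4 ^ n * z ^ n"
      by (simp add: x2 flip: power_mult_distrib)
    \<comment> \<open>This cancels \<open>pochhammer (1/2) n\<close> from the moment and leaves the
      denominator of \<open>bessel_clifford\<close>.\<close>
    also have "fact (2 * n) = 4 ^ n * pochhammer (1/2) n * (fact n :: real)"
      by (simp add: fact_double power_mult)
    also have "(- 1) ^ n / (4 ^ n * pochhammer (1/2) n * fact n) * ((- 1) ^ n * 4 ^ n * z ^ n) * (pochhammer (1/2) n / pochhammer (s + 1) n)
      = ((- 1) ^ n * (- 1) ^ n) * (z ^ n / (fact n * pochhammer (s + 1) n))"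
      using half by simp
    also have "(- 1) ^ n * (- 1) ^ n = (1::real)" by (simp flip: power_mult_distrib)
    finally show ?thesis by simp
  qed
  ultimately have "bessel_clifford (s + 1) z = (\<integral>u. cos (u * x) \<partial>kingman_kernel s)"
    unfolding bessel_clifford_def by (simp add: sums_unique[OF cos, symmetric] sums_iff)
  also have "\<bar>\<dots>\<bar> \<le> (\<integral>u. 1 \<partial>kingman_kernel s)"
    using integral_norm_bound[of "kingman_kernel s" "\<lambda>u. cos (u * x)"]
      integrable_kingman_kernel[OF s, of "\<lambda>u. cos (u * x)" 1]
    by (intro order.trans[OF integral_abs_bound integral_mono]) auto
  finally show ?thesis by (simp add: prob_space)
qed

section \<open>Transform of the Rayleigh law\<close>

lemma sets_rayleigh [measurable_cong, simp]: "sets (rayleigh s) = sets borel"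
  by (simp add: rayleigh_def)

lemma prob_space_rayleigh:
  assumes "s \<ge> -1/2"
  shows "prob_space (rayleigh s)"
  using nn_integral_rayleigh_power[OF assms, of 0] by (intro prob_spaceI) simp

lemma AE_rayleigh_pos: "AE x in rayleigh s. 0 < x"
  unfolding rayleigh_def by (subst AE_density) auto

text \<open>The moment of order 2n has \<open>pochhammer a n\<close> in its numerator, which cancels
  that of the kernel and leaves the series of exp (z / a). The second part also covers z < 0,
  through absolute convergence at |z|.\<close>

lemma integral_rayleigh_bessel_clifford:
  assumes s: "s \<ge> -1/2"
  shows "0 \<le> z \<Longrightarrow> (\<integral>\<^sup>+ x. ennreal (bessel_clifford (s + 1) (z * x\<^sup>2)) \<partial>rayleigh s) = ennreal (exp (z / (s + 1)))"
    and "(\<integral>x. bessel_clifford (s + 1) (z * x\<^sup>2) \<partial>rayleigh s) = exp (z / (s + 1))"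
proof -
  define a where "a = s + 1"
  have a: "0 < a" using s by (simp add: a_def)
  note poch = pochhammer_pos[OF a]
  define p where "p n x = x ^ (2 * n) / (fact n * pochhammer a n)" for n and x :: real
  have p_nonneg: "0 \<le> p n x" for n x
    using poch[of n] by (simp add: p_def)
  have [measurable]: "p n \<in> borel_measurable (rayleigh s)" for n
    unfolding p_def[abs_def] by measurable
  have sums: "(\<lambda>n. p n x * z ^ n) sums bessel_clifford a (z * x\<^sup>2)" for x z
    using bessel_clifford_sums[OF a, of "z * x\<^sup>2"]
    by (simp add: p_def power_mult_distrib mult.commute flip: power_mult)
  have nn_p: "(\<integral>\<^sup>+ x. ennreal (p n x) \<partial>rayleigh s) = ennreal (1 / (fact n * a ^ n))" for n
  proof -
    have "(\<integral>\<^sup>+ x. ennreal (p n x) \<partial>rayleigh s) = (\<integral>\<^sup>+ x. ennreal (1 / (fact n * pochhammer a n)) * ennreal (x ^ (2 * n)) \<partial>rayleigh s)"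
      using poch[of n] by (simp add: p_def flip: ennreal_mult'')
    also have "\<dots> = ennreal (1 / (fact n * pochhammer a n)) * ennreal (pochhammer a n / a ^ n)"
      by (subst nn_integral_cmult) (simp_all add: nn_integral_rayleigh_power[OF s] a_def)
    also have "\<dots> = ennreal (1 / (fact n * a ^ n))"
      using poch[of n] a by (simp flip: ennreal_mult'')
    finally show ?thesis .
  qed
  have exp_sums: "(\<lambda>n. 1 / (fact n * a ^ n) * z ^ n) sums exp (z / a)" for z
    using exp_converges[of "z / a"] by (simp add: divide_inverse mult_ac power_mult_distrib power_inverse)
  have nn: "(\<integral>\<^sup>+ x. ennreal (bessel_clifford a (z * x\<^sup>2)) \<partial>rayleigh s) = ennreal (exp (z / a))" if z: "0 \<le> z" for z
  proof -
    have "ennreal (bessel_clifford a (z * x\<^sup>2)) = (\<Sum>n. ennreal (p n x) * ennreal (z ^ n))" for x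
      using suminf_ennreal_eq[OF _ sums[of x z]] p_nonneg z by (simp add: ennreal_mult'')
    then have "(\<integral>\<^sup>+ x. ennreal (bessel_clifford a (z * x\<^sup>2)) \<partial>rayleigh s) = (\<Sum>n. ennreal (1 / (fact n * a ^ n)) * ennreal (z ^ n))"
      by (simp add: nn_integral_suminf nn_integral_multc nn_p)
    also have "\<dots> = ennreal (exp (z / a))"
    proof -
      have "ennreal (1 / (fact n * a ^ n)) * ennreal (z ^ n) = ennreal (1 / (fact n * a ^ n) * z ^ n)" for n
        using z by (intro ennreal_mult''[symmetric]) simp
      moreover have "(\<Sum>n. ennreal (1 / (fact n * a ^ n) * z ^ n)) = ennreal (exp (z / a))"
        by (rule suminf_ennreal_eq[OF _ exp_sums]) (use a z in simp)
      ultimately show ?thesis by (simp only:)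
    qed
    finally show ?thesis .
  qed
  show "0 \<le> z \<Longrightarrow> (\<integral>\<^sup>+ x. ennreal (bessel_clifford (s + 1) (z * x\<^sup>2)) \<partial>rayleigh s) = ennreal (exp (z / (s + 1)))"
    using nn by (simp add: a_def)
  note ps = integral_nonneg_power_series[where p = p and M = "rayleigh s" and f = "\<lambda>x z. bessel_clifford a (z * x\<^sup>2)", OF _ p_nonneg sums]
  have int: "integrable (rayleigh s) (p n)" for n by (rule ps) (auto simp: nn)
  have "(\<integral>x. p n x \<partial>rayleigh s) = 1 / (fact n * a ^ n)" for n
    using nn_p[of n] nn_integral_eq_integral[OF int, of n] p_nonneg a
    by (simp add: integral_nonneg_AE)
  moreover have "(\<lambda>n. (\<integral>x. p n x \<partial>rayleigh s) * z ^ n) sums (\<integral>x. bessel_clifford a (z * x\<^sup>2) \<partial>rayleigh s)"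
    by (rule ps) (auto simp: nn)
  ultimately show "(\<integral>x. bessel_clifford (s + 1) (z * x\<^sup>2) \<partial>rayleigh s) = exp (z / (s + 1))"
    using exp_sums[of z] by (simp add: sums_iff a_def)
qed

section \<open>Product measures\<close>

lemma borel_measurable_vec_nth' [measurable]:
  "(\<lambda>x. x $ i) \<in> borel_measurable (borel :: (real^'k) measure)"
  by (intro borel_measurable_continuous_onI continuous_intros)

lemma sets_vec_prod [simp, measurable_cong]: "sets (vec_prod \<mu>) = sets borel"
  by (simp add: vec_prod_def)

lemma measurable_vec_lambda_PiM:
  assumes "\<And>i. sets (\<mu> i) = sets borel"
  shows "(\<lambda>f. \<chi> i. f i) \<in> Pi\<^sub>M UNIV \<mu> \<rightarrow>\<^sub>M (borel :: (real^'k) measure)"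
proof -
  have sets: "sets (Pi\<^sub>M UNIV \<mu>) = sets (Pi\<^sub>M UNIV (\<lambda>_. borel))"
    by (intro sets_PiM_cong refl assms)
  show ?thesis
    unfolding measurable_cong_sets[OF sets refl] by (rule measurable_PiM_vec)
qed

lemma prob_space_vec_prod:
  fixes \<mu> :: "'k::finite \<Rightarrow> real measure"
  assumes "\<And>i. prob_space (\<mu> i)" and "\<And>i. sets (\<mu> i) = sets borel"
  shows "prob_space (vec_prod \<mu>)"
  unfolding vec_prod_def
  by (intro prob_space.prob_space_distr prob_space_PiM assms measurable_vec_lambda_PiM)

lemma nn_integral_vec_prod:
  fixes \<mu> :: "'k::finite \<Rightarrow> real measure"
  assumes \<mu>: "\<And>i. prob_space (\<mu> i)" "\<And>i. sets (\<mu> i) = sets borel"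
    and f [measurable]: "\<And>i. f i \<in> borel_measurable borel"
  shows "(\<integral>\<^sup>+ x. (\<Prod>i\<in>UNIV. f i (x $ i)) \<partial>vec_prod \<mu>) = (\<Prod>i\<in>UNIV. \<integral>\<^sup>+ x. f i x \<partial>\<mu> i)"
proof -
  interpret product_sigma_finite \<mu>
    by (intro product_sigma_finite.intro prob_space_imp_sigma_finite \<mu>)
  have "(\<integral>\<^sup>+ x. (\<Prod>i\<in>UNIV. f i (x $ i)) \<partial>vec_prod \<mu>) = (\<integral>\<^sup>+ x. (\<Prod>i\<in>UNIV. f i (x i)) \<partial>Pi\<^sub>M UNIV \<mu>)"
    unfolding vec_prod_def by (subst nn_integral_distr[OF measurable_vec_lambda_PiM[OF \<mu>(2)]]) simp_all
  also have "\<dots> = (\<Prod>i\<in>UNIV. \<integral>\<^sup>+ x. f i x \<partial>\<mu> i)"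
    by (rule product_nn_integral_prod) (use f in \<open>auto simp: measurable_cong_sets[OF \<mu>(2) refl]\<close>)
  finally show ?thesis .
qed

lemma integral_vec_prod:
  fixes \<mu> :: "'k::finite \<Rightarrow> real measure" and f :: "'k \<Rightarrow> real \<Rightarrow> real"
  assumes \<mu>: "\<And>i. prob_space (\<mu> i)" "\<And>i. sets (\<mu> i) = sets borel"
    and f: "\<And>i. integrable (\<mu> i) (f i)"
  shows "(\<integral>x. (\<Prod>i\<in>UNIV. f i (x $ i)) \<partial>vec_prod \<mu>) = (\<Prod>i\<in>UNIV. \<integral>x. f i x \<partial>\<mu> i)"
proof -
  interpret product_sigma_finite \<mu>
    by (intro product_sigma_finite.intro prob_space_imp_sigma_finite \<mu>)
  have [measurable]: "f i \<in> borel_measurable borel" for i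
    using borel_measurable_integrable[OF f[of i]] by (simp add: measurable_cong_sets[OF \<mu>(2) refl])
  have "(\<integral>x. (\<Prod>i\<in>UNIV. f i (x $ i)) \<partial>vec_prod \<mu>) = (\<integral>x. (\<Prod>i\<in>UNIV. f i (x i)) \<partial>Pi\<^sub>M UNIV \<mu>)"
    unfolding vec_prod_def by (subst integral_distr[OF measurable_vec_lambda_PiM[OF \<mu>(2)]]) simp_all
  also have "\<dots> = (\<Prod>i\<in>UNIV. \<integral>x. f i x \<partial>\<mu> i)"
    by (rule product_integral_prod) (auto intro: f)
  finally show ?thesis .
qed

text \<open>Boxes locate the support of a product law and show its concentration on the
  orthant.\<close>

lemma emeasure_vec_prod_box:
  fixes \<mu> :: "'k::finite \<Rightarrow> real measure"
  assumes \<mu>: "\<And>i. prob_space (\<mu> i)" "\<And>i. sets (\<mu> i) = sets borel"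
    and A: "\<And>i. A i \<in> sets borel"
  shows "emeasure (vec_prod \<mu>) {x. \<forall>i. x $ i \<in> A i} = (\<Prod>i\<in>UNIV. emeasure (\<mu> i) (A i))"
proof -
  have S: "{x :: real^'k. \<forall>i. x $ i \<in> A i} \<in> sets borel"
  proof -
    have "{x :: real^'k. \<forall>i. x $ i \<in> A i} = (\<Inter>i. (\<lambda>x. x $ i) -` A i \<inter> space borel)" by auto
    also have "\<dots> \<in> sets borel"
      by (intro sets.finite_INT measurable_sets[OF borel_measurable_vec_nth' A]) auto
    finally show ?thesis .
  qed
  have "emeasure (vec_prod \<mu>) {x. \<forall>i. x $ i \<in> A i} = (\<integral>\<^sup>+ x. indicator {x. \<forall>i. x $ i \<in> A i} x \<partial>vec_prod \<mu>)"
    using S by (subst nn_integral_indicator) auto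
  also have "\<dots> = (\<integral>\<^sup>+ x. (\<Prod>i\<in>UNIV. indicator (A i) (x $ i)) \<partial>vec_prod \<mu>)"
    by (intro nn_integral_cong) (auto simp: indicator_def)
  also have "\<dots> = (\<Prod>i\<in>UNIV. \<integral>\<^sup>+ x. indicator (A i) x \<partial>\<mu> i)"
    using A by (intro nn_integral_vec_prod \<mu>) auto
  also have "\<dots> = (\<Prod>i\<in>UNIV. emeasure (\<mu> i) (A i))"
    using A by (intro prod.cong refl nn_integral_indicator) (simp add: \<mu>)
  finally show ?thesis .
qed

lemma nn_integral_kingman_conv_return:
  assumes s: "s \<ge> -1/2" and [measurable]: "f \<in> borel_measurable borel"
  shows "(\<integral>\<^sup>+ z. f z \<partial>kingman_conv s (return borel x) (return borel y))
    = (\<integral>\<^sup>+ u. f (sqrt (x\<^sup>2 + 2 * u * x * y + y\<^sup>2)) \<partial>kingman_kernel s)"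
proof -
  interpret K: prob_space "kingman_kernel s" by (rule prob_space_kingman_kernel[OF s])
  interpret Y: prob_space "return borel y" by (rule prob_space_return) simp
  interpret YK: pair_prob_space "return borel y" "kingman_kernel s" ..
  interpret YK: prob_space "return borel y \<Otimes>\<^sub>M kingman_kernel s" by (rule YK.prob_space_axioms)
  define F where "F = (\<lambda>(x, y, u). f (sqrt (x\<^sup>2 + 2 * u * x * y + y\<^sup>2)))"
  have "F \<in> borel_measurable (borel \<Otimes>\<^sub>M (borel \<Otimes>\<^sub>M borel))" unfolding F_def by measurable
  moreover have sets: "sets (return borel x \<Otimes>\<^sub>M (return borel y \<Otimes>\<^sub>M kingman_kernel s)) = sets (borel \<Otimes>\<^sub>M (borel \<Otimes>\<^sub>M borel))"
    by (intro sets_pair_measure_cong) auto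
  ultimately have F: "F \<in> borel_measurable (return borel x \<Otimes>\<^sub>M (return borel y \<Otimes>\<^sub>M kingman_kernel s))"
    unfolding measurable_cong_sets[OF sets refl] by simp
  have F2: "(\<lambda>q. F (x', q)) \<in> borel_measurable (return borel y \<Otimes>\<^sub>M kingman_kernel s)" for x'
    using measurable_Pair2[OF F, of x'] by simp
  have "(\<integral>\<^sup>+ z. f z \<partial>kingman_conv s (return borel x) (return borel y))
     = (\<integral>\<^sup>+ p. f (case p of (x, y, u) \<Rightarrow> sqrt (x\<^sup>2 + 2 * u * x * y + y\<^sup>2))
          \<partial>(return borel x \<Otimes>\<^sub>M (return borel y \<Otimes>\<^sub>M kingman_kernel s)))"
    unfolding kingman_conv_def
    by (subst nn_integral_distr) (auto simp: measurable_kingman_fun cong: measurable_cong_sets intro!: measurable_kingman_fun)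
  also have "\<dots> = (\<integral>\<^sup>+ p. F p \<partial>(return borel x \<Otimes>\<^sub>M (return borel y \<Otimes>\<^sub>M kingman_kernel s)))"
    by (simp add: F_def case_prod_unfold)
  also have "\<dots> = (\<integral>\<^sup>+ x. \<integral>\<^sup>+ y. \<integral>\<^sup>+ u. f (sqrt (x\<^sup>2 + 2 * u * x * y + y\<^sup>2))
      \<partial>kingman_kernel s \<partial>return borel y \<partial>return borel x)"
    by (simp add: YK.nn_integral_fst[OF F, symmetric] K.nn_integral_fst[OF F2, symmetric]) (simp add: F_def)
  also have "\<dots> = (\<integral>\<^sup>+ u. f (sqrt (x\<^sup>2 + 2 * u * x * y + y\<^sup>2)) \<partial>kingman_kernel s)"
    by (subst nn_integral_return; simp?)+
  finally show ?thesis .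
qed

text \<open>Cauchy products, one coordinate at a time. Two coefficients are made explicit: the
  constant one fixes the value 1 at z = 0, and the linear one becomes the rate of the
  exponential.\<close>

lemma product_bessel_clifford_power_series:
  fixes w :: "'k::finite \<Rightarrow> real" and a :: real
  assumes a: "0 < a" and w: "\<And>j. 0 \<le> w j"
  obtains p :: "nat \<Rightarrow> real^'k \<Rightarrow> real"
  where "\<And>n. p n \<in> borel_measurable borel" and "\<And>n x. 0 \<le> p n x" and "\<And>x. p 0 x = 1"
    and "\<And>x. p 1 x = (\<Sum>j\<in>UNIV. w j * (x $ j)\<^sup>2) / a"
    and "\<And>x z. (\<lambda>n. p n x * z ^ n) sums (\<Prod>j\<in>UNIV. bessel_clifford a (z * (w j * (x $ j)\<^sup>2)))"
proof -
  have "\<exists>p :: nat \<Rightarrow> real^'k \<Rightarrow> real. (\<forall>n. p n \<in> borel_measurable borel) \<and> (\<forall>n x. 0 \<le> p n x) \<and> (\<forall>x. p 0 x = 1)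
    \<and> (\<forall>x. p 1 x = (\<Sum>j\<in>A. w j * (x $ j)\<^sup>2) / a)
    \<and> (\<forall>x z. (\<lambda>n. p n x * z ^ n) sums (\<Prod>j\<in>A. bessel_clifford a (z * (w j * (x $ j)\<^sup>2))))" for A
  proof (induction A rule: infinite_finite_induct)
    case empty
    have "(\<lambda>n. (if n = 0 then 1 else 0) * z ^ n) sums 1" for z :: real
      using sums_single[of 0 "\<lambda>n. z ^ n"] by (simp add: if_distrib[of "\<lambda>x. x * _"] cong: if_cong)
    then show ?case
      by (intro exI[of _ "\<lambda>n x. if n = 0 then 1 else 0"]) auto
  next
    case (insert j A)
    then obtain p :: "nat \<Rightarrow> real^'k \<Rightarrow> real" where p: "\<And>n. p n \<in> borel_measurable borel" "\<And>n x. 0 \<le> p n x" "\<And>x. p 0 x = 1"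
      "\<And>x. p 1 x = (\<Sum>j\<in>A. w j * (x $ j)\<^sup>2) / a"
      "\<And>x z. (\<lambda>n. p n x * z ^ n) sums (\<Prod>j\<in>A. bessel_clifford a (z * (w j * (x $ j)\<^sup>2)))"
      by blast
    note [measurable] = p(1)
    define c where "c n x = (w j * (x $ j)\<^sup>2) ^ n / (fact n * pochhammer a n)" for n and x :: "real^'k"
    have [measurable]: "c n \<in> borel_measurable borel" for n unfolding c_def[abs_def] by measurable
    have c_nonneg: "0 \<le> c n x" for n x
      using w[of j] pochhammer_pos[OF a, of n] by (simp add: c_def)
    have c_sums: "(\<lambda>n. c n x * z ^ n) sums bessel_clifford a (z * (w j * (x $ j)\<^sup>2))" for x z
      using bessel_clifford_sums[OF a, of "z * (w j * (x $ j)\<^sup>2)"]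
      by (simp add: c_def power_mult_distrib[of z] mult.commute)
    \<comment> \<open>Nonnegative coefficients turn convergence at |z| into absolute convergence at
      z, as the Cauchy product requires.\<close>
    have abs_summable: "summable (\<lambda>n. norm (q n * z ^ n))"
      if "\<And>n. 0 \<le> q n" "(\<lambda>n. q n * \<bar>z\<bar> ^ n) sums l" for q :: "nat \<Rightarrow> real" and z l
      using that by (simp add: abs_mult power_abs sums_iff)
    define P where "P n x = (\<Sum>i\<le>n. c i x * p (n - i) x)" for n x
    have "(\<lambda>n. P n x * z ^ n) sums (\<Prod>j\<in>insert j A. bessel_clifford a (z * (w j * (x $ j)\<^sup>2)))" for x z
    proof -
      have "(\<lambda>n. \<Sum>i\<le>n. (c i x * z ^ i) * (p (n - i) x * z ^ (n - i))) sums
         ((\<Sum>n. c n x * z ^ n) * (\<Sum>n. p n x * z ^ n))"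
        by (intro Cauchy_product_sums abs_summable[OF c_nonneg c_sums] abs_summable[OF p(2) p(5)])
      moreover have "(\<Sum>i\<le>n. (c i x * z ^ i) * (p (n - i) x * z ^ (n - i))) = P n x * z ^ n" for n
        unfolding P_def sum_distrib_right
      proof (intro sum.cong refl)
        fix i assume "i \<in> {..n}"
        then have "z ^ n = z ^ i * z ^ (n - i)" by (simp flip: power_add)
        then show "c i x * z ^ i * (p (n - i) x * z ^ (n - i)) = c i x * p (n - i) x * z ^ n" by simp
      qed
      ultimately show ?thesis
        using insert by (simp add: sums_unique[OF c_sums, symmetric] sums_unique[OF p(5), symmetric])
    qed
    moreover have "P n \<in> borel_measurable borel" for n unfolding P_def[abs_def] by measurable
    moreover have "0 \<le> P n x" for n x
      unfolding P_def by (intro sum_nonneg mult_nonneg_nonneg c_nonneg p)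
    moreover have "P 0 x = 1" for x by (simp add: P_def c_def p)
    moreover have "P 1 x = (\<Sum>j\<in>insert j A. w j * (x $ j)\<^sup>2) / a" for x
      using insert p(3,4) by (simp add: P_def c_def add_divide_distrib)
    ultimately show ?case by (intro exI[of _ P]) blast
  qed auto
  from this[of UNIV] show ?thesis using that by blast
qed

section \<open>The Bessel transform of a factor\<close>

text \<open>Weights of either sign are meant: nonnegative ones for the positive power series,
  nonpositive ones for the bounded Bessel kernel.\<close>

definition bessel_prod :: "real \<Rightarrow> ('k::finite \<Rightarrow> real) \<Rightarrow> real^'k \<Rightarrow> real" where
  "bessel_prod a w x = (\<Prod>j\<in>UNIV. bessel_clifford a (w j * (x $ j)\<^sup>2))"

lemma borel_measurable_bessel_prod [measurable]: "bessel_prod a w \<in> borel_measurable borel"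
  unfolding bessel_prod_def[abs_def] by measurable

lemma ennreal_bessel_prod:
  assumes "0 < a" "\<And>j. 0 \<le> w j"
  shows "ennreal (bessel_prod a w x) = (\<Prod>j\<in>UNIV. ennreal (bessel_clifford a (w j * (x $ j)\<^sup>2)))"
  unfolding bessel_prod_def
  using assms by (intro prod_ennreal[symmetric] order.trans[OF zero_le_one bessel_clifford_ge_1]) auto

lemma bessel_prod_ge_1:
  assumes "0 < a" "\<And>j. 0 \<le> w j"
  shows "1 \<le> bessel_prod a w x"
  unfolding bessel_prod_def using assms by (intro prod_ge_1 bessel_clifford_ge_1) auto

section \<open>Multiplicativity of the transform under the Kingman convolution\<close>

lemma sets_kingman_conv [simp, measurable_cong]: "sets (kingman_conv s \<mu> \<nu>) = sets borel"
  by (simp add: kingman_conv_def)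

lemma prob_space_kingman_conv_return:
  assumes s: "s \<ge> -1/2"
  shows "prob_space (kingman_conv s (return borel x) (return borel y))"
proof -
  interpret K: prob_space "kingman_kernel s" by (rule prob_space_kingman_kernel[OF s])
  interpret X: prob_space "return borel x" by (rule prob_space_return) simp
  interpret Y: prob_space "return borel y" by (rule prob_space_return) simp
  interpret YK: pair_prob_space "return borel y" "kingman_kernel s" ..
  interpret YK: prob_space "return borel y \<Otimes>\<^sub>M kingman_kernel s" by (rule YK.prob_space_axioms)
  interpret XYK: pair_prob_space "return borel x" "return borel y \<Otimes>\<^sub>M kingman_kernel s" ..
  have sets: "sets (return borel x \<Otimes>\<^sub>M (return borel y \<Otimes>\<^sub>M kingman_kernel s)) = sets (borel \<Otimes>\<^sub>M (borel \<Otimes>\<^sub>M borel))"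
    by (intro sets_pair_measure_cong) auto
  show ?thesis
    unfolding kingman_conv_def
    by (rule XYK.prob_space_distr) (unfold measurable_cong_sets[OF sets refl], rule measurable_kingman_fun)
qed

lemma nn_integral_kingman_conv_return_bessel_clifford:
  assumes s: "s \<ge> -1/2" and w: "0 \<le> w"
  shows "(\<integral>\<^sup>+ z. ennreal (bessel_clifford (s + 1) (w * z\<^sup>2)) \<partial>kingman_conv s (return borel x) (return borel y))
    = ennreal (bessel_clifford (s + 1) (w * x\<^sup>2)) * ennreal (bessel_clifford (s + 1) (w * y\<^sup>2))"
proof -
  have "(\<integral>\<^sup>+ z. ennreal (bessel_clifford (s + 1) (w * z\<^sup>2)) \<partial>kingman_conv s (return borel x) (return borel y))
     = (\<integral>\<^sup>+ u. ennreal (bessel_clifford (s + 1) (w * (sqrt (x\<^sup>2 + 2 * u * x * y + y\<^sup>2))\<^sup>2)) \<partial>kingman_kernel s)"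
    by (rule nn_integral_kingman_conv_return[OF s]) measurable
  \<comment> \<open>The convolution commutes with scaling, so the weight w is absorbed by scaling
    both points with sqrt w.\<close>
  also have "\<dots> = (\<integral>\<^sup>+ u. ennreal (bessel_clifford (s + 1) ((sqrt w * x)\<^sup>2 + 2 * u * (sqrt w * x) * (sqrt w * y) + (sqrt w * y)\<^sup>2)) \<partial>kingman_kernel s)"
  proof (rule nn_integral_cong_AE)
    show "AE u in kingman_kernel s. ennreal (bessel_clifford (s + 1) (w * (sqrt (x\<^sup>2 + 2 * u * x * y + y\<^sup>2))\<^sup>2))
      = ennreal (bessel_clifford (s + 1) ((sqrt w * x)\<^sup>2 + 2 * u * (sqrt w * x) * (sqrt w * y) + (sqrt w * y)\<^sup>2))"
      using AE_kingman_kernel[of s]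
    proof eventually_elim
      case (elim u)
      have "w * (sqrt (x\<^sup>2 + 2 * u * x * y + y\<^sup>2))\<^sup>2 = (sqrt w)\<^sup>2 * (x\<^sup>2 + 2 * u * x * y + y\<^sup>2)"
        using kingman_radicand_nonneg[OF elim, of x y] w by simp
      also have "\<dots> = (sqrt w * x)\<^sup>2 + 2 * u * (sqrt w * x) * (sqrt w * y) + (sqrt w * y)\<^sup>2"
        by (simp only: power2_eq_square) (simp add: algebra_simps)
      finally show ?case by simp
    qed
  qed
  also have "\<dots> = ennreal (bessel_clifford (s + 1) ((sqrt w * x)\<^sup>2) * bessel_clifford (s + 1) ((sqrt w * y)\<^sup>2))"
    by (rule nn_integral_kingman_kernel_bessel_clifford[OF s])
  also have "\<dots> = ennreal (bessel_clifford (s + 1) (w * x\<^sup>2)) * ennreal (bessel_clifford (s + 1) (w * y\<^sup>2))"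
    using w s bessel_clifford_ge_1[of "s + 1" "w * y\<^sup>2"] by (simp add: power_mult_distrib ennreal_mult'')
  finally show ?thesis .
qed

text \<open>The kernel and the convolution of two point masses are both products over the
  coordinates, so the inner integral factors for each pair of points, and Tonelli separates the
  rest. In \<open>ennreal\<close> the identity holds before either transform is known to be
  finite.\<close>

lemma nn_integral_kingman_conv_vec_bessel_prod:
  fixes G\<^sub>1 G\<^sub>2 :: "(real^'k) measure"
  assumes s: "s \<ge> -1/2" and G: "prob_space G\<^sub>1" "prob_space G\<^sub>2"
    and sets: "sets G\<^sub>1 = sets borel" "sets G\<^sub>2 = sets borel" and w: "\<And>j. 0 \<le> w j"
  shows "(\<integral>\<^sup>+ z. ennreal (bessel_prod (s + 1) w z) \<partial>kingman_conv_vec s G\<^sub>1 G\<^sub>2)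
    = (\<integral>\<^sup>+ x. ennreal (bessel_prod (s + 1) w x) \<partial>G\<^sub>1) * (\<integral>\<^sup>+ y. ennreal (bessel_prod (s + 1) w y) \<partial>G\<^sub>2)"
proof -
  define h where "h x = ennreal (bessel_prod (s + 1) w x)" for x
  have h [measurable]: "h \<in> borel_measurable borel" unfolding h_def[abs_def] by measurable
  have a: "0 < s + 1" using s by simp
  interpret G\<^sub>1: prob_space G\<^sub>1 by fact
  interpret G\<^sub>2: prob_space G\<^sub>2 by fact
  interpret pair_prob_space G\<^sub>1 G\<^sub>2 ..
  have pair: "sets (G\<^sub>1 \<Otimes>\<^sub>M G\<^sub>2) = sets (borel \<Otimes>\<^sub>M borel)"
    by (intro sets_pair_measure_cong sets)
  have "(\<lambda>(x, y). kingman_conv_point s x y) \<in> G\<^sub>1 \<Otimes>\<^sub>M G\<^sub>2 \<rightarrow>\<^sub>M subprob_algebra borel"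
    unfolding measurable_cong_sets[OF pair refl]
    by (rule measurable_prob_algebraD[OF measurable_kingman_conv_point[OF s]])
  then have "(\<integral>\<^sup>+ z. h z \<partial>kingman_conv_vec s G\<^sub>1 G\<^sub>2)
     = (\<integral>\<^sup>+ p. \<integral>\<^sup>+ z. h z \<partial>(case p of (x, y) \<Rightarrow> kingman_conv_point s x y) \<partial>(G\<^sub>1 \<Otimes>\<^sub>M G\<^sub>2))"
    unfolding kingman_conv_vec_def by (rule nn_integral_bind[OF h])
  also have "\<dots> = (\<integral>\<^sup>+ p. h (fst p) * h (snd p) \<partial>(G\<^sub>1 \<Otimes>\<^sub>M G\<^sub>2))"
  proof (rule nn_integral_cong)
    fix p :: "(real^'k) \<times> (real^'k)"
    obtain x y where p: "p = (x, y)" by (cases p)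
    have "(\<integral>\<^sup>+ z. h z \<partial>kingman_conv_point s x y)
      = (\<Prod>j\<in>UNIV. \<integral>\<^sup>+ z. ennreal (bessel_clifford (s + 1) (w j * z\<^sup>2))
           \<partial>kingman_conv s (return borel (x $ j)) (return borel (y $ j)))"
      unfolding kingman_conv_point_def h_def ennreal_bessel_prod[OF a w]
      by (rule nn_integral_vec_prod) (auto intro: prob_space_kingman_conv_return[OF s])
    also have "\<dots> = h x * h y"
      unfolding h_def ennreal_bessel_prod[OF a w]
      by (simp only: nn_integral_kingman_conv_return_bessel_clifford[OF s w] prod.distrib)
    finally show "(\<integral>\<^sup>+ z. h z \<partial>(case p of (x, y) \<Rightarrow> kingman_conv_point s x y)) = h (fst p) * h (snd p)"
      by (simp add: p)
  qed
  also have "\<dots> = (\<integral>\<^sup>+ x. \<integral>\<^sup>+ y. h x * h y \<partial>G\<^sub>2 \<partial>G\<^sub>1)"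
  proof -
    have "(\<lambda>p. h (fst p) * h (snd p)) \<in> borel_measurable (G\<^sub>1 \<Otimes>\<^sub>M G\<^sub>2)"
      unfolding measurable_cong_sets[OF pair refl] by measurable
    from G\<^sub>2.nn_integral_fst[OF this] show ?thesis by simp
  qed
  also have "\<dots> = (\<integral>\<^sup>+ x. h x \<partial>G\<^sub>1) * (\<integral>\<^sup>+ y. h y \<partial>G\<^sub>2)"
    using h by (simp add: nn_integral_cmult nn_integral_multc measurable_cong_sets[OF sets(1) refl] measurable_cong_sets[OF sets(2) refl])
  finally show ?thesis by (simp add: h_def)
qed

lemma nn_integral_rayleigh_vec_bessel_prod:
  assumes s: "s \<ge> -1/2" and w: "\<And>j. 0 \<le> w j"
  shows "(\<integral>\<^sup>+ x. ennreal (bessel_prod (s + 1) w x) \<partial>rayleigh_vec s) = ennreal (exp ((\<Sum>j\<in>UNIV. w j) / (s + 1)))"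
proof -
  have a: "0 < s + 1" using s by simp
  have "(\<integral>\<^sup>+ x. ennreal (bessel_prod (s + 1) w x) \<partial>rayleigh_vec s)
     = (\<Prod>j\<in>UNIV. \<integral>\<^sup>+ x. ennreal (bessel_clifford (s + 1) (w j * x\<^sup>2)) \<partial>rayleigh s)"
    unfolding rayleigh_vec_def ennreal_bessel_prod[OF a w]
    by (rule nn_integral_vec_prod) (auto intro: prob_space_rayleigh[OF s])
  also have "\<dots> = (\<Prod>j\<in>UNIV. ennreal (exp (w j / (s + 1))))"
    using integral_rayleigh_bessel_clifford(1)[OF s w] by simp
  also have "\<dots> = ennreal (exp ((\<Sum>j\<in>UNIV. w j) / (s + 1)))"
    by (simp add: prod_ennreal exp_sum sum_divide_distrib)
  finally show ?thesis .
qed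

text \<open>Along each ray \<open>z \<mapsto> z * w\<close> the transform is a power series in \<open>z\<close> with nonnegative
  coefficients, so the one-variable factorization lemma gives an exponential; its rate is the
  first-order coefficient, which is linear in \<open>w\<close>.\<close>

lemma integral_bessel_prod_of_factor:
  fixes M N :: "(real^'k) measure"
  assumes a: "0 < a" and prob: "prob_space M" "prob_space N"
    and sets: "sets M = sets borel" "sets N = sets borel"
    and factor: "\<And>w. (\<And>j. 0 \<le> w j) \<Longrightarrow>
      (\<integral>\<^sup>+ x. ennreal (bessel_prod a w x) \<partial>M) * (\<integral>\<^sup>+ x. ennreal (bessel_prod a w x) \<partial>N)
        = ennreal (exp ((\<Sum>j\<in>UNIV. w j) / a))"
    and w: "\<And>j. 0 \<le> w j"
  shows "(\<integral>\<^sup>+ x. ennreal (bessel_prod a w x) \<partial>M) < \<infinity>"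
    and "(\<integral>x. bessel_prod a (\<lambda>j. z * w j) x \<partial>M) = exp (z * ((\<Sum>j\<in>UNIV. w j * (\<integral>x. (x $ j)\<^sup>2 \<partial>M)) / a))"
proof -
  \<comment> \<open>A lower bound on one factor is what turns a finite product into a bound on the
    other.\<close>
  have ge1: "1 \<le> (\<integral>\<^sup>+ x. ennreal (bessel_prod a w x) \<partial>K)"
    if "prob_space K" "\<And>j. 0 \<le> w j" for K :: "(real^'k) measure" and w
  proof -
    interpret prob_space K by fact
    have "(\<integral>\<^sup>+ x. 1 \<partial>K) \<le> (\<integral>\<^sup>+ x. ennreal (bessel_prod a w x) \<partial>K)"
      using bessel_prod_ge_1[OF a that(2)] by (intro nn_integral_mono) simp
    then show ?thesis by (simp add: emeasure_space_1)
  qed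
  have fin: "(\<integral>\<^sup>+ x. ennreal (bessel_prod a w x) \<partial>M) < \<infinity>" "(\<integral>\<^sup>+ x. ennreal (bessel_prod a w x) \<partial>N) < \<infinity>"
    if "\<And>j. 0 \<le> w j" for w
  proof -
    let ?A = "\<integral>\<^sup>+ x. ennreal (bessel_prod a w x) \<partial>M" and ?B = "\<integral>\<^sup>+ x. ennreal (bessel_prod a w x) \<partial>N"
    have "?A * 1 \<le> ?A * ?B" "1 * ?B \<le> ?A * ?B"
      using ge1[OF prob(1) that] ge1[OF prob(2) that] by (intro mult_mono; simp)+
    then show "?A < \<infinity>" "?B < \<infinity>"
      unfolding factor[OF that] by (auto intro: order.strict_trans1)
  qed
  show "(\<integral>\<^sup>+ x. ennreal (bessel_prod a w x) \<partial>M) < \<infinity>" by (rule fin(1)[OF w])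
  have series: "\<exists>P :: nat \<Rightarrow> real^'k \<Rightarrow> real. (\<forall>n. P n \<in> borel_measurable borel) \<and> (\<forall>n x. 0 \<le> P n x) \<and> (\<forall>x. P 0 x = 1)
    \<and> (\<forall>x. P 1 x = (\<Sum>j\<in>UNIV. w j * (x $ j)\<^sup>2) / a)
    \<and> (\<forall>x z. (\<lambda>n. P n x * z ^ n) sums bessel_prod a (\<lambda>j. z * w j) x)" if "\<And>j. 0 \<le> w j" for w
    unfolding bessel_prod_def mult.assoc
    by (rule product_bessel_clifford_power_series[where w = w, OF a that]) blast+
  have integrable_P: "integrable K (P n)"
      "(\<lambda>n. (\<integral>x. P n x \<partial>K) * z ^ n) sums (\<integral>x. bessel_prod a (\<lambda>j. z * w j) x \<partial>K)"
    if K: "K = M \<or> K = N" and w: "\<And>j. 0 \<le> w j" and P: "\<And>n. P n \<in> borel_measurable borel" "\<And>n x. 0 \<le> P n x"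
      "\<And>x z. (\<lambda>n. P n x * z ^ n) sums bessel_prod a (\<lambda>j. z * w j) x" for K P w n z
  proof -
    have sK: "sets K = sets borel" using K sets by auto
    have "(\<integral>\<^sup>+ x. ennreal (bessel_prod a (\<lambda>j. r * w j) x) \<partial>K) < \<infinity>" if "0 \<le> r" for r
      using K fin[of "\<lambda>j. r * w j"] w that by auto
    moreover have "P n \<in> borel_measurable K" for n
      using P(1) by (simp add: measurable_cong_sets[OF sK refl])
    ultimately show "integrable K (P n)" "(\<lambda>n. (\<integral>x. P n x \<partial>K) * z ^ n) sums (\<integral>x. bessel_prod a (\<lambda>j. z * w j) x \<partial>K)"
      using integral_nonneg_power_series[of P K "\<lambda>x z. bessel_prod a (\<lambda>j. z * w j) x", OF _ P(2,3)] by blast+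
  qed
  \<comment> \<open>With all weights 1 the linear coefficient is |x|^2 / a and dominates every
    squared coordinate; the given w may vanish in some coordinates and would not control
    those.\<close>
  have square_int: "integrable M (\<lambda>x. (x $ j)\<^sup>2)" for j
  proof -
    from series[of "\<lambda>_. 1"] obtain P :: "nat \<Rightarrow> real^'k \<Rightarrow> real"
      where P: "\<And>n. P n \<in> borel_measurable borel" "\<And>n x. 0 \<le> P n x"
      "\<And>x. P 1 x = (\<Sum>j\<in>UNIV. 1 * (x $ j)\<^sup>2) / a"
      "\<And>x z. (\<lambda>n. P n x * z ^ n) sums bessel_prod a (\<lambda>j. z * 1) x" by auto
    have "integrable M (P 1)"
      by (rule integrable_P(1)[of M "\<lambda>_. 1" P, OF _ _ P(1,2,4)]) auto
    then have int: "integrable M (\<lambda>x. a * P 1 x)" by simp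
    have "(x $ j)\<^sup>2 \<le> a * P 1 x" for x
      unfolding P(3) using a member_le_sum[of j UNIV "\<lambda>j. (x $ j)\<^sup>2"] by simp
    then have bound: "AE x in M. norm ((x $ j)\<^sup>2) \<le> norm (a * P 1 x)"
      by (intro AE_I2) (metis abs_ge_self order.trans power2_abs real_norm_def abs_power2)
    show ?thesis
      by (rule Bochner_Integration.integrable_bound[OF int _ bound]) (simp add: measurable_cong_sets[OF sets(1) refl])
  qed
  from series[of w, OF w] obtain P :: "nat \<Rightarrow> real^'k \<Rightarrow> real"
    where P: "\<And>n. P n \<in> borel_measurable borel" "\<And>n x. 0 \<le> P n x"
      "\<And>x z. (\<lambda>n. P n x * z ^ n) sums bessel_prod a (\<lambda>j. z * w j) x"
      and P01: "\<And>x. P 0 x = 1" "\<And>x. P 1 x = (\<Sum>j\<in>UNIV. w j * (x $ j)\<^sup>2) / a" by blast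
  note IM = integrable_P[where K = M and w = w and P = P, OF _ w P] and IN = integrable_P[where K = N and w = w and P = P, OF _ w P]
  interpret M: prob_space M by fact
  interpret N: prob_space N by fact
  define c where "c = (\<Sum>j\<in>UNIV. w j) / a"
  have "(\<Sum>n. (\<integral>x. P n x \<partial>M) * z ^ n) = exp ((\<integral>x. P 1 x \<partial>M) * z)"
  proof (rule nonneg_power_series_factor_of_exp[where q = "\<lambda>n. \<integral>x. P n x \<partial>N" and c = c])
    show "0 \<le> c" using w a by (auto simp: c_def intro!: divide_nonneg_pos sum_nonneg)
    show "0 \<le> (\<integral>x. P n x \<partial>M)" "0 \<le> (\<integral>x. P n x \<partial>N)" for n using P(2) by auto
    show "(\<integral>x. P 0 x \<partial>M) = 1" "(\<integral>x. P 0 x \<partial>N) = 1"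
      unfolding P01 by (simp_all add: M.prob_space N.prob_space)
    show "summable (\<lambda>n. (\<integral>x. P n x \<partial>M) * z ^ n)" "summable (\<lambda>n. (\<integral>x. P n x \<partial>N) * z ^ n)" for z
      using IM(2)[of z] IN(2)[of z] by (auto simp: sums_iff)
    fix r :: real assume r: "0 \<le> r"
    have nn: "(\<integral>\<^sup>+ x. ennreal (bessel_prod a (\<lambda>j. r * w j) x) \<partial>K) = ennreal (\<integral>x. bessel_prod a (\<lambda>j. r * w j) x \<partial>K)"
      if K: "K = M \<or> K = N" for K
    proof (rule nn_integral_eq_integral)
      have pos: "0 \<le> bessel_prod a (\<lambda>j. r * w j) x" for x
        using bessel_prod_ge_1[OF a, of "\<lambda>j. r * w j" x] w r by simp
      then show "AE x in K. 0 \<le> bessel_prod a (\<lambda>j. r * w j) x" by simp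
      have sK: "sets K = sets borel" using K sets by auto
      show "integrable K (bessel_prod a (\<lambda>j. r * w j))"
        using pos fin[of "\<lambda>j. r * w j"] w r K
        by (intro integrableI_nonneg) (auto simp: measurable_cong_sets[OF sK refl])
    qed
    have "ennreal (exp (c * r)) = ennreal (\<integral>x. bessel_prod a (\<lambda>j. r * w j) x \<partial>M) * ennreal (\<integral>x. bessel_prod a (\<lambda>j. r * w j) x \<partial>N)"
      using factor[of "\<lambda>j. r * w j"] nn[of M] nn[of N] w r
      by (simp add: c_def mult.commute flip: sum_distrib_left)
    moreover have "0 \<le> (\<integral>x. bessel_prod a (\<lambda>j. r * w j) x \<partial>K)" for K
      using bessel_prod_ge_1[OF a, of "\<lambda>j. r * w j"] w r
      by (intro integral_nonneg_AE AE_I2) (auto intro: order.trans[OF zero_le_one])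
    ultimately have "exp (c * r) = (\<integral>x. bessel_prod a (\<lambda>j. r * w j) x \<partial>M) * (\<integral>x. bessel_prod a (\<lambda>j. r * w j) x \<partial>N)"
      by (simp flip: ennreal_mult)
    then show "(\<Sum>n. (\<integral>x. P n x \<partial>M) * r ^ n) * (\<Sum>n. (\<integral>x. P n x \<partial>N) * r ^ n) = exp (c * r)"
      using IM(2)[of r] IN(2)[of r] by (simp add: sums_iff)
  qed
  moreover have "(\<integral>x. P 1 x \<partial>M) = (\<Sum>j\<in>UNIV. w j * (\<integral>x. (x $ j)\<^sup>2 \<partial>M)) / a"
    unfolding P01 using square_int by simp
  ultimately show "(\<integral>x. bessel_prod a (\<lambda>j. z * w j) x \<partial>M) = exp (z * ((\<Sum>j\<in>UNIV. w j * (\<integral>x. (x $ j)\<^sup>2 \<partial>M)) / a))"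
    using IM(2)[of z] by (simp add: sums_iff mult.commute)
qed

section \<open>Uniqueness\<close>

text \<open>Both measures are carried by the compact set S, so Stone-Weierstrass transfers the
  equality from R to all continuous functions; from these it passes to closed sets, which generate
  the Borel sets.\<close>

lemma measure_eqI_function_ring:
  fixes M N :: "'a::euclidean_space measure"
  assumes ring: "function_ring_on R S"
    and prob: "prob_space M" "prob_space N" and sets: "sets M = sets borel" "sets N = sets borel"
    and AE: "AE x in M. x \<in> S" "AE x in N. x \<in> S"
    and R: "\<And>f. f \<in> R \<Longrightarrow> f \<in> borel_measurable borel"
    and eq: "\<And>f. f \<in> R \<Longrightarrow> (\<integral>x. f x \<partial>M) = (\<integral>x. f x \<partial>N)"
  shows "M = N"
proof -
  interpret function_ring_on R S by fact
  have int: "integrable K f"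
    if K: "K = M \<or> K = N" and f: "f \<in> borel_measurable borel" and c: "continuous_on S f" for K and f :: "'a \<Rightarrow> real"
  proof -
    have "bounded (f ` S)"
      by (intro compact_imp_bounded compact_continuous_image c compact)
    then obtain B where B: "\<And>x. x \<in> S \<Longrightarrow> norm (f x) \<le> B" unfolding bounded_iff by auto
    interpret prob_space K using K prob by auto
    have "AE x in K. norm (f x) \<le> B" using K AE by (auto elim!: eventually_mono simp: B[unfolded real_norm_def])
    moreover have "f \<in> borel_measurable K"
      using f K sets by (auto simp: measurable_cong_sets[OF sets(1) refl] measurable_cong_sets[OF sets(2) refl])
    ultimately show ?thesis by (rule integrable_const_bound)
  qed
  have cont_eq: "(\<integral>x. f x \<partial>M) = (\<integral>x. f x \<partial>N)" if f: "continuous_on UNIV f" for f :: "'a \<Rightarrow> real"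
  proof (rule ccontr)
    assume ne: "(\<integral>x. f x \<partial>M) \<noteq> (\<integral>x. f x \<partial>N)"
    \<comment> \<open>A third of the gap: two approximation errors of at most e each cannot bridge
      it.\<close>
    define e where "e = \<bar>(\<integral>x. f x \<partial>M) - (\<integral>x. f x \<partial>N)\<bar> / 3"
    have e: "e > 0" using ne by (simp add: e_def)
    have fS: "continuous_on S f" using f by (rule continuous_on_subset) simp
    obtain g where g: "g \<in> R" "\<And>x. x \<in> S \<Longrightarrow> \<bar>f x - g x\<bar> < e"
      using Stone_Weierstrass_basic[OF fS e] by blast
    have close: "\<bar>(\<integral>x. f x \<partial>K) - (\<integral>x. g x \<partial>K)\<bar> \<le> e" if K: "K = M \<or> K = N" for K
    proof -
      interpret prob_space K using K prob by auto
      have ints: "integrable K f" "integrable K g"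
        by (rule int[OF K borel_measurable_continuous_onI[OF f] fS],
            rule int[OF K R[OF g(1)] continuous[OF g(1)]])
      have "\<bar>(\<integral>x. f x \<partial>K) - (\<integral>x. g x \<partial>K)\<bar> = \<bar>\<integral>x. f x - g x \<partial>K\<bar>" using ints by simp
      also have "\<dots> \<le> (\<integral>x. \<bar>f x - g x\<bar> \<partial>K)" by (rule integral_abs_bound)
      also have "\<dots> \<le> (\<integral>x. e \<partial>K)"
        using ints K AE by (intro integral_mono_AE) (auto elim!: eventually_mono dest!: g(2))
      finally show ?thesis by (simp add: prob_space)
    qed
    show False
      using close[of M] close[of N] eq[OF g(1)] e unfolding e_def by (simp add: abs_if split: if_splits)
  qed
  \<comment> \<open>The empty set is set apart because \<open>infdist\<close> to it is 0 by
    convention, which would make the functions \<open>f n\<close> below constantly 1.\<close>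
  have closed_eq: "emeasure M C = emeasure N C" if C: "closed C" "C \<noteq> {}" for C
  proof -
    interpret M: prob_space M by fact
    interpret N: prob_space N by fact
    \<comment> \<open>Continuous functions of the distance that decrease to the indicator of
      C.\<close>
    define f where "f n x = max 0 (1 - real n * infdist x C)" for n x
    have f_cont: "continuous_on UNIV (f n)" for n
      unfolding f_def by (intro continuous_intros)
    have lim: "(\<lambda>n. \<integral>x. f n x \<partial>K) \<longlonglongrightarrow> measure K C" if K: "K = M \<or> K = N" for K
    proof -
      interpret prob_space K using K by (auto intro: prob)
      have sK: "sets K = sets borel" using K sets by auto
      have "(\<lambda>n. \<integral>x. f n x \<partial>K) \<longlonglongrightarrow> (\<integral>x. indicator C x \<partial>K)"
      proof (rule integral_dominated_convergence[where w = "\<lambda>_. 1"])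
        show "AE x in K. (\<lambda>n. f n x) \<longlonglongrightarrow> indicator C x"
        proof (rule AE_I2)
          fix x
          show "(\<lambda>n. f n x) \<longlonglongrightarrow> indicator C x"
          proof (cases "x \<in> C")
            case True
            then show ?thesis by (simp add: f_def)
          next
            case False
            then have d: "infdist x C > 0"
              using C in_closed_iff_infdist_zero[OF C] infdist_nonneg[of x C] by force
            have "eventually (\<lambda>n. real n * infdist x C > 1) sequentially"
              using d by real_asymp
            then have "eventually (\<lambda>n. f n x = 0) sequentially"
              by eventually_elim (simp add: f_def)
            then show ?thesis using False by (simp add: tendsto_eventually)
          qed
        qed
        show "f n \<in> borel_measurable K" for n
          using borel_measurable_continuous_onI[OF f_cont] by (simp add: measurable_cong_sets[OF sK refl])
        show "AE x in K. norm (f n x) \<le> 1" for n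
          by (auto simp: f_def infdist_nonneg)
      qed (use C sK in \<open>auto simp: measurable_cong_sets[OF sK refl]\<close>)
      then show ?thesis using C sK by simp
    qed
    have "measure M C = measure N C"
      using lim[of M] lim[of N] unfolding cont_eq[OF f_cont] by (blast intro: LIMSEQ_unique)
    then show ?thesis by (simp add: M.emeasure_eq_measure N.emeasure_eq_measure)
  qed
  show ?thesis
  proof (rule measure_eqI_generator_eq[where E = "Collect closed" and \<Omega> = UNIV and A = "\<lambda>_. UNIV"])
    show "sets M = sigma_sets UNIV (Collect closed)" "sets N = sigma_sets UNIV (Collect closed)"
      unfolding sets by (simp_all add: borel_eq_closed)
    interpret M: prob_space M by fact
    show "emeasure M UNIV \<noteq> \<infinity>" for i :: nat by simp
    fix X :: "'a set" assume "X \<in> Collect closed"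
    then show "emeasure M X = emeasure N X" using closed_eq[of X] by (cases "X = {}") auto
  qed (auto simp: Int_stable_def)
qed

text \<open>The polynomial functions of the coordinates. Generating them by monomials and sums alone
  reduces a statement that is linear in f to monomials; closure under products is derived.\<close>

inductive_set monomial_sums :: "(real^'k \<Rightarrow> real) set" where
  monomial: "(\<lambda>y. c * (\<Prod>j\<in>UNIV. (y $ j) ^ n j)) \<in> monomial_sums"
| add: "f \<in> monomial_sums \<Longrightarrow> g \<in> monomial_sums \<Longrightarrow> (\<lambda>y. f y + g y) \<in> monomial_sums"

lemma monomial_sums_mult:
  assumes "f \<in> monomial_sums" "g \<in> monomial_sums"
  shows "(\<lambda>y. f y * g y) \<in> monomial_sums"
  using assms(1)
proof induction
  case (monomial c n)
  show ?case using assms(2)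
  proof induction
    case (monomial d m)
    then show ?case
      using monomial_sums.monomial[of "c * d" "\<lambda>j. n j + m j"]
      by (simp add: power_add prod.distrib mult_ac)
  next
    case (add f g)
    then show ?case by (simp add: distrib_left monomial_sums.add)
  qed
next
  case (add f g)
  then show ?case by (simp add: distrib_right monomial_sums.add)
qed

lemma continuous_on_monomial_sums: "f \<in> monomial_sums \<Longrightarrow> continuous_on A f"
  by (induction rule: monomial_sums.induct) (auto intro!: continuous_intros)

lemma function_ring_on_monomial_sums:
  assumes "compact (S :: (real^'k) set)"
  shows "function_ring_on monomial_sums S"
proof
  show "(\<lambda>_. c) \<in> monomial_sums" for c :: real
    using monomial[of c "\<lambda>_. 0"] by simp
  fix x y :: "real^'k" assume "x \<noteq> y"
  then obtain j where j: "x $ j \<noteq> y $ j" by (auto simp: vec_eq_iff)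
  have coord: "1 * (\<Prod>i\<in>UNIV. (z $ i) ^ (if i = j then 1 else 0)) = z $ j" for z :: "real^'k"
  proof -
    have "(\<Prod>i\<in>UNIV. (z $ i) ^ (if i = j then 1 else 0)) = (\<Prod>i\<in>UNIV. if i = j then z $ i else 1)"
      by (intro prod.cong) auto
    also have "\<dots> = z $ j" by (subst prod.delta) auto
    finally show ?thesis by (simp only: mult_1)
  qed
  have "(\<lambda>z :: real^'k. z $ j) \<in> monomial_sums"
    using monomial[of 1 "\<lambda>i. if i = j then 1 else 0"] unfolding coord .
  then show "\<exists>f\<in>monomial_sums. f x \<noteq> f y"
    by (rule bexI[rotated]) (rule j)
qed (auto intro: assms continuous_on_monomial_sums monomial_sums_mult monomial_sums.add)

text \<open>Substituting \<open>y\<^sub>j = exp (- x\<^sub>j\<^sup>2)\<close> turns the hypothesis into equality of the moments of two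
  measures on the unit cube.\<close>

lemma measure_eqI_gaussian_transform:
  fixes M N :: "(real^'k) measure"
  assumes prob: "prob_space M" "prob_space N" and sets: "sets M = sets borel" "sets N = sets borel"
    and AE: "AE x in M. x \<in> orthant" "AE x in N. x \<in> orthant"
    and eq: "\<And>t. (\<And>j. 0 \<le> t j) \<Longrightarrow>
      (\<integral>x. (\<Prod>j\<in>UNIV. exp (- t j * (x $ j)\<^sup>2)) \<partial>M) = (\<integral>x. (\<Prod>j\<in>UNIV. exp (- t j * (x $ j)\<^sup>2)) \<partial>N)"
  shows "M = N"
proof -
  define T :: "real^'k \<Rightarrow> real^'k" where "T x = (\<chi> j. exp (- (x $ j)\<^sup>2))" for x
  \<comment> \<open>U inverts T on the orthant, where the nonnegative root is the right one, so a
    measure carried there is recovered from its image under T.\<close>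
  define U :: "real^'k \<Rightarrow> real^'k" where "U y = (\<chi> j. sqrt (- ln (y $ j)))" for y
  have [measurable]: "T \<in> borel_measurable borel"
    unfolding T_def[abs_def] by (intro borel_measurable_continuous_onI continuous_intros)
  have U_nth: "(\<lambda>y. U y $ j) \<in> borel_measurable borel" for j
    unfolding U_def vec_lambda_beta by measurable
  have "U \<in> borel_measurable borel"
    by (subst borel_measurable_euclidean_space) (auto simp: Basis_vec_def inner_axis U_nth)
  note this [measurable]
  have UT: "U (T x) = x" if "x \<in> orthant" for x
    using that by (simp add: U_def T_def orthant_def vec_eq_iff)
  have T_MN [measurable]: "T \<in> M \<rightarrow>\<^sub>M borel" "T \<in> N \<rightarrow>\<^sub>M borel"
    unfolding measurable_cong_sets[OF sets(1) refl] measurable_cong_sets[OF sets(2) refl] by measurable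
  have inverse: "distr (distr K borel T) borel U = K"
    if K: "K = M \<or> K = N" for K
  proof -
    have sK: "sets K = sets borel" using K sets by auto
    have [measurable]: "T \<in> K \<rightarrow>\<^sub>M borel" using K by auto
    have "distr (distr K borel T) borel U = distr K borel (U \<circ> T)"
      by (rule distr_distr) auto
    also have "\<dots> = distr K K (\<lambda>x. x)"
    proof (rule distr_cong_AE)
      show "AE x in K. (U \<circ> T) x = x" using K AE by (auto simp: UT elim!: eventually_mono)
      show "U \<circ> T \<in> K \<rightarrow>\<^sub>M borel" by (rule measurable_comp[of _ _ borel]) auto
    qed (auto simp: sK)
    finally show ?thesis by simp
  qed
  have "distr M borel T = distr N borel T"
  proof (rule measure_eqI_function_ring)
    show "function_ring_on monomial_sums (cbox 0 1 :: (real^'k) set)"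
      by (intro function_ring_on_monomial_sums compact_cbox)
    show "prob_space (distr M borel T)" "prob_space (distr N borel T)"
      by (auto intro: prob_space.prob_space_distr prob)
    have "T x \<in> cbox 0 1" for x by (simp add: T_def mem_box_cart)
    then show "AE x in distr M borel T. x \<in> cbox 0 1" "AE x in distr N borel T. x \<in> cbox 0 1"
      by (simp_all add: AE_distr_iff)
    fix f :: "real^'k \<Rightarrow> real" assume f: "f \<in> monomial_sums"
    show "f \<in> borel_measurable borel"
      by (rule borel_measurable_continuous_onI[OF continuous_on_monomial_sums[OF f]])
    \<comment> \<open>Integrability is carried along because the case of a sum splits the
      integral.\<close>
    have "(\<forall>K. K = M \<or> K = N \<longrightarrow> integrable (distr K borel T) f) \<and> (\<integral>x. f x \<partial>distr M borel T) = (\<integral>x. f x \<partial>distr N borel T)"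
      using f
    proof induction
      case (monomial c n)
      have meas: "(\<lambda>y :: real^'k. c * (\<Prod>j\<in>UNIV. (y $ j) ^ n j)) \<in> borel_measurable borel"
        by (rule borel_measurable_continuous_onI) (intro continuous_intros)
      \<comment> \<open>A monomial with exponents n pulls back under T to the Gaussian kernel with t
        = n.\<close>
      have E: "c * (\<Prod>j\<in>UNIV. (T x $ j) ^ n j) = c * (\<Prod>j\<in>UNIV. exp (- real (n j) * (x $ j)\<^sup>2))" for x
        by (simp add: T_def flip: exp_of_nat_mult)
      have "integrable (distr K borel T) (\<lambda>y. c * (\<Prod>j\<in>UNIV. (y $ j) ^ n j))" if K: "K = M \<or> K = N" for K
      proof -
        interpret prob_space K using K prob by auto
        have TK: "T \<in> K \<rightarrow>\<^sub>M borel" using K by auto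
        have "integrable K (\<lambda>x. c * (\<Prod>j\<in>UNIV. (T x $ j) ^ n j))"
        proof (rule integrable_const_bound[of _ "\<bar>c\<bar>"])
          have "\<bar>c * (\<Prod>j\<in>UNIV. (T x $ j) ^ n j)\<bar> \<le> \<bar>c\<bar> * 1" for x
            unfolding abs_mult by (intro mult_left_mono) (auto simp: abs_prod T_def power_abs intro!: prod_le_1 power_le_one)
          then show "AE x in K. norm (c * (\<Prod>j\<in>UNIV. (T x $ j) ^ n j)) \<le> \<bar>c\<bar>" by simp
          show "(\<lambda>x. c * (\<Prod>j\<in>UNIV. (T x $ j) ^ n j)) \<in> borel_measurable K"
            by (rule measurable_compose[OF TK meas])
        qed
        then show ?thesis using integrable_distr_eq[OF TK meas] by simp
      qed
      moreover have "(\<integral>y. c * (\<Prod>j\<in>UNIV. (y $ j) ^ n j) \<partial>distr M borel T) = (\<integral>y. c * (\<Prod>j\<in>UNIV. (y $ j) ^ n j) \<partial>distr N borel T)"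
        unfolding integral_distr[OF T_MN(1) meas] integral_distr[OF T_MN(2) meas] E
        using eq[of "\<lambda>j. real (n j)"] by simp
      ultimately show ?case by blast
    next
      case (add f g)
      then show ?case by simp
    qed
    then show "(\<integral>x. f x \<partial>distr M borel T) = (\<integral>x. f x \<partial>distr N borel T)" by (rule conjunct2)
  qed auto
  then have "distr (distr M borel T) borel U = distr (distr N borel T) borel U" by (rule arg_cong)
  then show ?thesis unfolding inverse[OF disjI1[OF refl]] inverse[OF disjI2[OF refl]] .
qed

section \<open>Dimension\<close>

lemma sets_scale_distr [simp, measurable_cong]: "sets (scale_distr c \<mu>) = sets borel"
  by (simp add: scale_distr_def)

lemma measurable_scale_rayleigh: "(\<lambda>x. c * x) \<in> rayleigh s \<rightarrow>\<^sub>M borel"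
  by measurable

lemma prob_space_scale_rayleigh:
  assumes "s \<ge> -1/2"
  shows "prob_space (scale_distr c (rayleigh s))"
  unfolding scale_distr_def
  by (rule prob_space.prob_space_distr[OF prob_space_rayleigh[OF assms] measurable_scale_rayleigh])

lemma emeasure_rayleigh_interval_pos:
  assumes s: "s \<ge> -1/2" and "0 \<le> a" "a < b"
  shows "0 < emeasure (rayleigh s) {a<..<b}"
proof -
  define d where "d x = (if 0 < x then 2 * (s + 1) powr (s + 1) / Gamma (s + 1) * x powr (2 * s + 1) * exp (- (s + 1) * x\<^sup>2) else 0)" for x :: real
  have d_pos: "0 < d x" if "x > 0" for x
    using that s Gamma_real_pos[of "s + 1"] by (simp add: d_def)
  have [measurable]: "d \<in> borel_measurable borel" unfolding d_def[abs_def] by measurable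
  have em: "emeasure (rayleigh s) {a<..<b} = (\<integral>\<^sup>+ x. ennreal (d x) * indicator {a<..<b} x \<partial>lborel)"
    unfolding rayleigh_def d_def[symmetric] by (rule emeasure_density) auto
  have "emeasure (rayleigh s) {a<..<b} \<noteq> 0"
  proof
    assume "emeasure (rayleigh s) {a<..<b} = 0"
    then have "AE x in lborel. ennreal (d x) * indicator {a<..<b} x = 0"
      unfolding em by (subst (asm) nn_integral_0_iff_AE) auto
    then have "AE x in lborel. x \<notin> {a<..<b}"
    proof eventually_elim
      case (elim x)
      then show ?case using d_pos[of x] \<open>0 \<le> a\<close> by (auto simp: ennreal_eq_0_iff split: split_indicator_asm)
    qed
    then have "emeasure lborel {a<..<b} = 0"
      by (subst (asm) AE_iff_measurable[of "{a<..<b}"]) auto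
    then show False using \<open>a < b\<close> by simp
  qed
  then show ?thesis by (simp add: zero_less_iff_neq_zero)
qed

lemma emeasure_scale_rayleigh_interval_pos:
  assumes s: "s \<ge> -1/2" and l: "0 \<le> l" and x: "if l = 0 then x = 0 else 0 < x" and e: "0 < e"
  shows "0 < emeasure (scale_distr l (rayleigh s)) {x - e<..<x + e}"
proof (cases "l = 0")
  case True
  have "emeasure (scale_distr l (rayleigh s)) {x - e<..<x + e} = emeasure (rayleigh s) (space (rayleigh s))"
    using True x e unfolding scale_distr_def
    by (subst emeasure_distr) (auto intro!: arg_cong2[where f = emeasure])
  then show ?thesis
    using prob_space.emeasure_space_1[OF prob_space_rayleigh[OF s]] by simp
next
  case False
  then have "0 < l" "0 < x" using l x by auto
  \<comment> \<open>Only the right half of the interval around x is used; its preimage lies where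
    the Rayleigh density is positive.\<close>
  have "0 < emeasure (rayleigh s) {x / l<..<(x + e) / l}"
    using \<open>0 < l\<close> \<open>0 < x\<close> e by (intro emeasure_rayleigh_interval_pos[OF s]) (auto simp: divide_strict_right_mono)
  also have "\<dots> \<le> emeasure (rayleigh s) ((\<lambda>y. l * y) -` {x - e<..<x + e} \<inter> space (rayleigh s))"
  proof (rule emeasure_mono)
    show "{x / l<..<(x + e) / l} \<subseteq> (\<lambda>y. l * y) -` {x - e<..<x + e} \<inter> space (rayleigh s)"
      using \<open>0 < l\<close> e by (auto simp: field_simps rayleigh_def)
    show "(\<lambda>y. l * y) -` {x - e<..<x + e} \<inter> space (rayleigh s) \<in> sets (rayleigh s)"
      by (rule measurable_sets[OF measurable_scale_rayleigh]) simp
  qed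
  also have "\<dots> = emeasure (scale_distr l (rayleigh s)) {x - e<..<x + e}"
    unfolding scale_distr_def by (subst emeasure_distr) auto
  finally show ?thesis .
qed

text \<open>The support is enclosed between the coordinate subspace of the nonzero scales and the
  open positive orthant of that subspace. Both have the same affine hull, so the two bounds
  determine the dimension.\<close>

lemma prod_scale_rayleigh_support:
  fixes l :: "'k::finite \<Rightarrow> real"
  assumes s: "s \<ge> -1/2" and l: "\<And>r. 0 \<le> l r"
  shows "distr_support (vec_prod (\<lambda>r. scale_distr (l r) (rayleigh s))) \<subseteq> {x. \<forall>r. l r = 0 \<longrightarrow> x $ r = 0}"
    and "{x. \<forall>r. if l r = 0 then x $ r = 0 else 0 < x $ r} \<subseteq> distr_support (vec_prod (\<lambda>r. scale_distr (l r) (rayleigh s)))"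
proof -
  note box = emeasure_vec_prod_box[OF prob_space_scale_rayleigh[OF s] sets_scale_distr]
  show "distr_support (vec_prod (\<lambda>r. scale_distr (l r) (rayleigh s))) \<subseteq> {x. \<forall>r. l r = 0 \<longrightarrow> x $ r = 0}"
  proof (intro subsetI CollectI allI impI, rule ccontr)
    fix x :: "real^'k" and r assume x: "x \<in> distr_support (vec_prod (\<lambda>r. scale_distr (l r) (rayleigh s)))" and r: "l r = 0" "x $ r \<noteq> 0"
    \<comment> \<open>A coordinate of scale 0 has the unit mass at 0 as its law, so a box that
      avoids 0 there is null.\<close>
    define A :: "'k \<Rightarrow> real set" where "A i = (if i = r then - {0} else UNIV)" for i
    have "open {x :: real^'k. x $ r \<noteq> 0}"
      by (intro open_Collect_neq continuous_intros)
    then have "0 < emeasure (vec_prod (\<lambda>r. scale_distr (l r) (rayleigh s))) {x. x $ r \<noteq> 0}"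
      using x r unfolding distr_support_def by blast
    also have "{x :: real^'k. x $ r \<noteq> 0} = {x. \<forall>i. x $ i \<in> A i}" by (auto simp: A_def)
    also have "emeasure (vec_prod (\<lambda>r. scale_distr (l r) (rayleigh s))) {x. \<forall>i. x $ i \<in> A i}
       = (\<Prod>i\<in>UNIV. emeasure (scale_distr (l i) (rayleigh s)) (A i))"
      by (rule box) (simp add: A_def)
    also have "\<dots> = 0"
    proof (rule prod_zero)
      have "(\<lambda>x. l r * x) -` A r \<inter> space (rayleigh s) = {}"
        using r by (auto simp: A_def)
      then have "emeasure (scale_distr (l r) (rayleigh s)) (A r) = 0"
        unfolding scale_distr_def
        by (subst emeasure_distr[OF measurable_scale_rayleigh]) (simp_all add: A_def)
      then show "\<exists>i\<in>UNIV. emeasure (scale_distr (l i) (rayleigh s)) (A i) = 0" by blast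
    qed simp
    finally show False by simp
  qed
  show "{x. \<forall>r. if l r = 0 then x $ r = 0 else 0 < x $ r} \<subseteq> distr_support (vec_prod (\<lambda>r. scale_distr (l r) (rayleigh s)))"
  proof
    fix x :: "real^'k" assume "x \<in> {x. \<forall>r. if l r = 0 then x $ r = 0 else 0 < x $ r}"
    then have x: "if l r = 0 then x $ r = 0 else 0 < x $ r" for r by blast
    show "x \<in> distr_support (vec_prod (\<lambda>r. scale_distr (l r) (rayleigh s)))"
      unfolding distr_support_def
    proof (intro CollectI allI impI)
      fix U :: "(real^'k) set" assume U: "open U" "x \<in> U"
      then obtain e where e: "0 < e" "ball x e \<subseteq> U" using open_contains_ball by blast
      \<comment> \<open>Dividing by the number of coordinates lets the l1 bound on the norm place
        the box inside the ball of radius e.\<close>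
      define \<delta> where "\<delta> = e / real CARD('k)"
      have \<delta>: "0 < \<delta>" using e by (simp add: \<delta>_def)
      have "{y. \<forall>i. y $ i \<in> {x $ i - \<delta><..<x $ i + \<delta>}} \<subseteq> ball x e"
      proof
        fix y :: "real^'k" assume "y \<in> {y. \<forall>i. y $ i \<in> {x $ i - \<delta><..<x $ i + \<delta>}}"
        then have y: "\<bar>(x - y) $ i\<bar> < \<delta>" for i by (auto simp: abs_less_iff algebra_simps)
        have "norm (x - y) \<le> (\<Sum>i\<in>UNIV. \<bar>(x - y) $ i\<bar>)" by (rule norm_le_l1_cart)
        also have "\<dots> < (\<Sum>i\<in>(UNIV :: 'k set). \<delta>)" using y by (intro sum_strict_mono) auto
        also have "\<dots> = e" by (simp add: \<delta>_def)
        finally show "y \<in> ball x e" by (simp add: dist_norm)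
      qed
      then have sub: "{y. \<forall>i. y $ i \<in> {x $ i - \<delta><..<x $ i + \<delta>}} \<subseteq> U" using e by blast
      have "0 < (\<Prod>i\<in>UNIV. emeasure (scale_distr (l i) (rayleigh s)) {x $ i - \<delta><..<x $ i + \<delta>})"
        using emeasure_scale_rayleigh_interval_pos[OF s l x \<delta>]
        by (simp add: zero_less_iff_neq_zero)
      also have "\<dots> = emeasure (vec_prod (\<lambda>r. scale_distr (l r) (rayleigh s))) {y. \<forall>i. y $ i \<in> {x $ i - \<delta><..<x $ i + \<delta>}}"
        by (rule box[symmetric]) simp
      also have "\<dots> \<le> emeasure (vec_prod (\<lambda>r. scale_distr (l r) (rayleigh s))) U"
        using U by (intro emeasure_mono sub) simp
      finally show "0 < emeasure (vec_prod (\<lambda>r. scale_distr (l r) (rayleigh s))) U" .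
    qed
  qed
qed

lemma distr_dim_prod_scale_rayleigh:
  fixes l :: "'k::finite \<Rightarrow> real"
  assumes s: "s \<ge> -1/2" and l: "\<And>r. 0 \<le> l r"
  shows "distr_dim (vec_prod (\<lambda>r. scale_distr (l r) (rayleigh s))) = int (card {r. l r \<noteq> 0})"
proof -
  define V where "V = {x :: real^'k. \<forall>r. l r = 0 \<longrightarrow> x $ r = 0}"
  define Q where "Q = {x :: real^'k. \<forall>r. if l r = 0 then x $ r = 0 else 0 < x $ r}"
  define D where "D = distr_support (vec_prod (\<lambda>r. scale_distr (l r) (rayleigh s)))"
  have QDV: "Q \<subseteq> D" "D \<subseteq> V"
    using prod_scale_rayleigh_support[OF s, of l, OF l] by (auto simp: Q_def D_def V_def)
  have "V \<subseteq> affine hull Q"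
  proof
    fix v assume v: "v \<in> V"
    \<comment> \<open>Large enough on the active coordinates that adding v keeps them positive: no
      coordinate of v exceeds \<open>norm v\<close> in modulus.\<close>
    define p :: "real^'k" where "p = (\<chi> r. if l r = 0 then 0 else norm v + 1)"
    have "p \<in> Q" "2 *\<^sub>R p \<in> Q" by (auto simp: Q_def p_def add_nonneg_pos)
    moreover have "p + v \<in> Q"
    proof -
      have "0 < norm v + 1 + v $ r" for r
        using component_le_norm_cart[of v r] by linarith
      then show ?thesis using v by (simp add: Q_def p_def V_def)
    qed
    \<comment> \<open>v = (p + v) + p - 2p is an affine combination of three points of Q, with
      coefficients 1, 1 and -1.\<close>
    ultimately have "(p + v) + 1 *\<^sub>R (p - 2 *\<^sub>R p) \<in> affine hull Q"
      by (intro mem_affine_3_minus affine_affine_hull hull_inc)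
    then show "v \<in> affine hull Q" by (simp add: scaleR_2)
  qed
  from aff_dim_subset[OF this] have "aff_dim V \<le> aff_dim Q" by (simp only: aff_dim_affine_hull)
  moreover have "aff_dim Q \<le> aff_dim D" "aff_dim D \<le> aff_dim V"
    using QDV by (auto intro: aff_dim_subset)
  moreover have "aff_dim V = int (card {r. l r \<noteq> 0})"
  proof -
    have "subspace V" unfolding V_def subspace_def by auto
    moreover have "dim V = card {r. l r \<noteq> 0}"
      using dim_substandard_cart[of "{r. l r \<noteq> 0}", where 'a = real] by (simp add: V_def dim_vec_eq)
    ultimately show ?thesis by (simp add: aff_dim_subspace)
  qed
  ultimately show ?thesis by (simp add: distr_dim_def D_def)
qed

section \<open>The decomposition\<close>

lemma abs_bessel_prod_le_1:
  assumes "s \<ge> -1/2" "\<And>j. w j \<le> 0"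
  shows "\<bar>bessel_prod (s + 1) w x\<bar> \<le> 1"
  unfolding bessel_prod_def abs_prod
  using assms by (intro prod_le_1) (auto intro!: abs_bessel_clifford_le_1 mult_nonpos_nonneg)

text \<open>Averaging the hypothesis over Rayleigh distributed parameters replaces the Bessel kernels
  by Gaussians.\<close>

lemma measure_eqI_bessel_transform:
  fixes M N :: "(real^'k) measure"
  assumes s: "s \<ge> -1/2"
    and prob: "prob_space M" "prob_space N" and sets: "sets M = sets borel" "sets N = sets borel"
    and AE: "AE x in M. x \<in> orthant" "AE x in N. x \<in> orthant"
    and eq: "\<And>w. (\<And>j. 0 \<le> w j) \<Longrightarrow>
      (\<integral>x. bessel_prod (s + 1) (\<lambda>j. - w j) x \<partial>M) = (\<integral>x. bessel_prod (s + 1) (\<lambda>j. - w j) x \<partial>N)"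
  shows "M = N"
proof (rule measure_eqI_gaussian_transform[OF prob sets AE])
  fix t :: "'k \<Rightarrow> real" assume t: "\<And>j. 0 \<le> t j"
  define a where "a = s + 1"
  have a: "0 < a" using s by (simp add: a_def)
  \<comment> \<open>The kernel depends on parameter and point symmetrically, so it can be averaged
    over r by \<open>integral_rayleigh_bessel_clifford\<close>; the factor a cancels the division by
    s + 1 in the resulting exponent.\<close>
  define W where "W r j = a * t j * (r $ j)\<^sup>2" for r :: "real^'k" and j
  have W: "0 \<le> W r j" for r j using a t by (simp add: W_def)
  have gauss: "(\<Prod>j\<in>UNIV. exp (- t j * (x $ j)\<^sup>2)) = (\<integral>r. bessel_prod a (\<lambda>j. - W r j) x \<partial>rayleigh_vec s)" for x :: "real^'k"
  proof -
    interpret R: prob_space "rayleigh s" by (rule prob_space_rayleigh[OF s])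
    have "integrable (rayleigh s) (\<lambda>r. bessel_clifford a (- (a * t j * (x $ j)\<^sup>2) * r\<^sup>2))" for j
    proof (rule R.integrable_const_bound[of _ 1])
      have "- (a * t j * (x $ j)\<^sup>2) * r\<^sup>2 \<le> 0" for r :: real
        using a t by (intro mult_nonpos_nonneg) auto
      then show "AE r in rayleigh s. norm (bessel_clifford a (- (a * t j * (x $ j)\<^sup>2) * r\<^sup>2)) \<le> 1"
        unfolding a_def real_norm_def using abs_bessel_clifford_le_1[OF s] by (intro AE_I2) blast
    qed measurable
    then have "(\<integral>r. (\<Prod>j\<in>UNIV. bessel_clifford a (- (a * t j * (x $ j)\<^sup>2) * (r $ j)\<^sup>2)) \<partial>rayleigh_vec s)
       = (\<Prod>j\<in>UNIV. \<integral>r. bessel_clifford a (- (a * t j * (x $ j)\<^sup>2) * r\<^sup>2) \<partial>rayleigh s)"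
      unfolding rayleigh_vec_def by (intro integral_vec_prod) (auto intro: prob_space_rayleigh[OF s])
    also have "\<dots> = (\<Prod>j\<in>UNIV. exp (- t j * (x $ j)\<^sup>2))"
      unfolding a_def integral_rayleigh_bessel_clifford(2)[OF s] using s by simp
    finally show ?thesis by (simp add: bessel_prod_def W_def mult_ac)
  qed
  \<comment> \<open>Nonpositive weights bound the kernel by 1, which makes it integrable for the
    product of two probability measures.\<close>
  have fubini: "(\<integral>x. (\<Prod>j\<in>UNIV. exp (- t j * (x $ j)\<^sup>2)) \<partial>K) = (\<integral>r. \<integral>x. bessel_prod a (\<lambda>j. - W r j) x \<partial>K \<partial>rayleigh_vec s)"
    if K: "prob_space K" "sets K = sets borel" for K
  proof -
    interpret K: prob_space K by fact
    interpret R: prob_space "rayleigh_vec s :: (real^'k) measure"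
      unfolding rayleigh_vec_def by (rule prob_space_vec_prod) (auto intro: prob_space_rayleigh[OF s])
    interpret P: pair_prob_space K "rayleigh_vec s :: (real^'k) measure" ..
    have "sets (K \<Otimes>\<^sub>M (rayleigh_vec s :: (real^'k) measure)) = sets (borel \<Otimes>\<^sub>M borel)"
      by (intro sets_pair_measure_cong K) (simp add: rayleigh_vec_def)
    note cong = measurable_cong_sets[OF this refl]
    have "integrable (K \<Otimes>\<^sub>M rayleigh_vec s) (\<lambda>(x, r). bessel_prod a (\<lambda>j. - W r j) x)"
    proof (rule P.integrable_const_bound[of _ 1])
      show "AE p in K \<Otimes>\<^sub>M rayleigh_vec s. norm (case p of (x, r) \<Rightarrow> bessel_prod a (\<lambda>j. - W r j) x) \<le> 1"
        by (intro AE_I2) (auto simp: a_def intro!: abs_bessel_prod_le_1[OF s] W)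
      show "(\<lambda>(x, r). bessel_prod a (\<lambda>j. - W r j) x) \<in> borel_measurable (K \<Otimes>\<^sub>M rayleigh_vec s)"
        unfolding cong bessel_prod_def W_def by measurable
    qed
    from P.Fubini_integral[OF this] show ?thesis unfolding gauss by simp
  qed
  show "(\<integral>x. (\<Prod>j\<in>UNIV. exp (- t j * (x $ j)\<^sup>2)) \<partial>M) = (\<integral>x. (\<Prod>j\<in>UNIV. exp (- t j * (x $ j)\<^sup>2)) \<partial>N)"
    unfolding fubini[OF prob(1) sets(1)] fubini[OF prob(2) sets(2)] a_def using eq[OF W] by simp
qed

lemma AE_prod_scale_rayleigh_orthant:
  fixes l :: "'k::finite \<Rightarrow> real"
  assumes s: "s \<ge> -1/2" and l: "\<And>r. 0 \<le> l r"
  shows "AE x in vec_prod (\<lambda>r. scale_distr (l r) (rayleigh s)). x \<in> orthant"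
proof -
  interpret prob_space "vec_prod (\<lambda>r. scale_distr (l r) (rayleigh s))"
    by (intro prob_space_vec_prod prob_space_scale_rayleigh s) simp
  have one: "emeasure (scale_distr (l r) (rayleigh s)) {0..} = 1" for r
  proof (rule prob_space.emeasure_eq_1_AE[OF prob_space_scale_rayleigh[OF s]])
    show "AE x in scale_distr (l r) (rayleigh s). x \<in> {0..}"
      unfolding scale_distr_def
    proof (subst AE_distr_iff[OF measurable_scale_rayleigh])
      show "AE x in rayleigh s. l r * x \<in> {0..}"
        using AE_rayleigh_pos[of s] by eventually_elim (use l in simp)
    qed auto
  qed simp
  have "emeasure (vec_prod (\<lambda>r. scale_distr (l r) (rayleigh s))) {x. \<forall>i. x $ i \<in> {0..}} = 1"
    by (subst emeasure_vec_prod_box[OF prob_space_scale_rayleigh[OF s]]) (auto simp: one)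
  then have "AE x in vec_prod (\<lambda>r. scale_distr (l r) (rayleigh s)). x \<in> {x. \<forall>i. x $ i \<in> {0..}}"
    by (intro AE_prob_1) (simp add: measure_def)
  then show ?thesis by (simp add: orthant_def)
qed

text \<open>The Rayleigh law has second moment 1, which forces each scale to be the root of the
  second moment of its coordinate. The second conclusion keeps the transform itself, for comparing
  the exponents of the two factors.\<close>

lemma factor_of_rayleigh_transform:
  fixes M N :: "(real^'k) measure"
  assumes s: "s \<ge> -1/2" and prob: "prob_space M" "prob_space N"
    and sets: "sets M = sets borel" "sets N = sets borel"
    and AE: "AE x in M. x \<in> orthant"
    and factor: "\<And>w. (\<And>j. 0 \<le> w j) \<Longrightarrow>
      (\<integral>\<^sup>+ x. ennreal (bessel_prod (s + 1) w x) \<partial>M) * (\<integral>\<^sup>+ x. ennreal (bessel_prod (s + 1) w x) \<partial>N)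
        = ennreal (exp ((\<Sum>j\<in>UNIV. w j) / (s + 1)))"
  shows "M = vec_prod (\<lambda>j. scale_distr (sqrt (\<integral>x. (x $ j)\<^sup>2 \<partial>M)) (rayleigh s))"
    and "(\<And>j. 0 \<le> w j) \<Longrightarrow> (\<integral>\<^sup>+ x. ennreal (bessel_prod (s + 1) w x) \<partial>M)
      = ennreal (exp ((\<Sum>j\<in>UNIV. w j * (\<integral>x. (x $ j)\<^sup>2 \<partial>M)) / (s + 1)))"
proof -
  have a: "0 < s + 1" using s by simp
  define m where "m j = (\<integral>x. (x $ j)\<^sup>2 \<partial>M)" for j
  have m: "0 \<le> m j" for j by (simp add: m_def)
  note transform = integral_bessel_prod_of_factor[OF a prob sets factor, folded m_def]
  define R where "R = vec_prod (\<lambda>j. scale_distr (sqrt (m j)) (rayleigh s))"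
  have "M = R"
  proof (rule measure_eqI_bessel_transform[OF s prob(1) _ sets(1) _ AE])
    show "prob_space R" unfolding R_def by (intro prob_space_vec_prod prob_space_scale_rayleigh s) simp
    show "sets R = sets borel" by (simp add: R_def)
    show "AE x in R. x \<in> orthant" unfolding R_def by (intro AE_prod_scale_rayleigh_orthant s) (simp add: m)
    fix w :: "'k \<Rightarrow> real" assume w: "\<And>j. 0 \<le> w j"
    have "integrable (scale_distr (sqrt (m j)) (rayleigh s)) (\<lambda>x. bessel_clifford (s + 1) (- w j * x\<^sup>2))" for j
    proof (rule finite_measure.integrable_const_bound[of _ _ 1])
      show "finite_measure (scale_distr (sqrt (m j)) (rayleigh s))"
        by (rule prob_space.finite_measure[OF prob_space_scale_rayleigh[OF s]])
      have "- w j * x\<^sup>2 \<le> 0" for x :: real using w by (simp add: mult_nonneg_nonneg)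
      then show "AE x in scale_distr (sqrt (m j)) (rayleigh s). norm (bessel_clifford (s + 1) (- w j * x\<^sup>2)) \<le> 1"
        unfolding real_norm_def using abs_bessel_clifford_le_1[OF s] by (intro AE_I2) blast
    qed measurable
    then have "(\<integral>x. bessel_prod (s + 1) (\<lambda>j. - w j) x \<partial>R)
       = (\<Prod>j\<in>UNIV. \<integral>x. bessel_clifford (s + 1) (- w j * x\<^sup>2) \<partial>scale_distr (sqrt (m j)) (rayleigh s))"
      unfolding bessel_prod_def R_def by (intro integral_vec_prod prob_space_scale_rayleigh s) auto
    also have "\<dots> = (\<Prod>j\<in>UNIV. exp (- w j * m j / (s + 1)))"
    proof (rule prod.cong[OF refl])
      fix j
      have "(\<integral>x. bessel_clifford (s + 1) (- w j * x\<^sup>2) \<partial>scale_distr (sqrt (m j)) (rayleigh s))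
         = (\<integral>x. bessel_clifford (s + 1) (- w j * (sqrt (m j) * x)\<^sup>2) \<partial>rayleigh s)"
        unfolding scale_distr_def by (rule integral_distr[OF measurable_scale_rayleigh]) measurable
      also have "\<dots> = (\<integral>x. bessel_clifford (s + 1) ((- w j * m j) * x\<^sup>2) \<partial>rayleigh s)"
        using m[of j] by (simp add: power_mult_distrib mult.assoc)
      also have "\<dots> = exp (- w j * m j / (s + 1))"
        by (rule integral_rayleigh_bessel_clifford(2)[OF s])
      finally show "(\<integral>x. bessel_clifford (s + 1) (- w j * x\<^sup>2) \<partial>scale_distr (sqrt (m j)) (rayleigh s))
        = exp (- w j * m j / (s + 1))" .
    qed
    also have "\<dots> = exp (- ((\<Sum>j\<in>UNIV. w j * m j) / (s + 1)))"
      by (simp add: sum_negf sum_divide_distrib flip: exp_sum)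
    \<comment> \<open>The transform of M is taken at z = -1 on the ray through w; both exponents are
      minus the weighted sum of second moments over s + 1.\<close>
    finally show "(\<integral>x. bessel_prod (s + 1) (\<lambda>j. - w j) x \<partial>M) = (\<integral>x. bessel_prod (s + 1) (\<lambda>j. - w j) x \<partial>R)"
      using transform(2)[of w "-1"] w by simp
  qed
  then show "M = vec_prod (\<lambda>j. scale_distr (sqrt (\<integral>x. (x $ j)\<^sup>2 \<partial>M)) (rayleigh s))"
    by (simp only: R_def m_def)
  assume w: "\<And>j. 0 \<le> w j"
  have pos: "0 \<le> bessel_prod (s + 1) w x" for x
    using bessel_prod_ge_1[of "s + 1" w x, OF a w] by simp
  have "integrable M (bessel_prod (s + 1) w)"
    using pos transform(1)[of w] w
    by (intro integrableI_nonneg) (auto simp: measurable_cong_sets[OF sets(1) refl])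
  then have "(\<integral>\<^sup>+ x. ennreal (bessel_prod (s + 1) w x) \<partial>M) = ennreal (\<integral>x. bessel_prod (s + 1) w x \<partial>M)"
    by (rule nn_integral_eq_integral) (simp add: pos)
  then show "(\<integral>\<^sup>+ x. ennreal (bessel_prod (s + 1) w x) \<partial>M)
      = ennreal (exp ((\<Sum>j\<in>UNIV. w j * (\<integral>x. (x $ j)\<^sup>2 \<partial>M)) / (s + 1)))"
    using transform(2)[of w 1] w by (simp add: m_def)
qed

theorem theorem5:
  fixes s :: real and G\<^sub>1 G\<^sub>2 :: "(real^'k) measure"
  assumes "s \<ge> -1/2"
    and "G\<^sub>1 \<in> distributions_on orthant" and "G\<^sub>2 \<in> distributions_on orthant"
    and "rayleigh_vec s = kingman_conv_vec s G\<^sub>1 G\<^sub>2"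
  shows "rayleighian s G\<^sub>1 \<and> rayleighian s G\<^sub>2 \<and>
    (\<exists>l\<^sub>1 l\<^sub>2 :: 'k \<Rightarrow> real.
       (\<forall>r. 0 \<le> l\<^sub>1 r \<and> 0 \<le> l\<^sub>2 r) \<and>
       G\<^sub>1 = vec_prod (\<lambda>r. scale_distr (l\<^sub>1 r) (rayleigh s)) \<and>
       G\<^sub>2 = vec_prod (\<lambda>r. scale_distr (l\<^sub>2 r) (rayleigh s)) \<and>
       int (card {r. l\<^sub>1 r \<noteq> 0}) = distr_dim G\<^sub>1 \<and>
       int (card {r. l\<^sub>2 r \<noteq> 0}) = distr_dim G\<^sub>2 \<and>
       (\<forall>r. (l\<^sub>1 r)\<^sup>2 + (l\<^sub>2 r)\<^sup>2 = 1))"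
proof -
  note s = assms(1)
  have prob: "prob_space G\<^sub>1" "prob_space G\<^sub>2" and sets: "sets G\<^sub>1 = sets borel" "sets G\<^sub>2 = sets borel"
    and AE: "AE x in G\<^sub>1. x \<in> orthant" "AE x in G\<^sub>2. x \<in> orthant"
    using assms(2,3) by (auto simp: distributions_on_def space_prob_algebra)
  define m\<^sub>1 m\<^sub>2 where "m\<^sub>1 r = (\<integral>x. (x $ r)\<^sup>2 \<partial>G\<^sub>1)" and "m\<^sub>2 r = (\<integral>x. (x $ r)\<^sup>2 \<partial>G\<^sub>2)" for r
  have m: "0 \<le> m\<^sub>1 r" "0 \<le> m\<^sub>2 r" for r by (simp_all add: m\<^sub>1_def m\<^sub>2_def)
  define l\<^sub>1 l\<^sub>2 where "l\<^sub>1 r = sqrt (m\<^sub>1 r)" and "l\<^sub>2 r = sqrt (m\<^sub>2 r)" for r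
  have l: "0 \<le> l\<^sub>1 r" "0 \<le> l\<^sub>2 r" for r by (simp_all add: l\<^sub>1_def l\<^sub>2_def m)
  have factor: "(\<integral>\<^sup>+ x. ennreal (bessel_prod (s + 1) w x) \<partial>G\<^sub>1) * (\<integral>\<^sup>+ x. ennreal (bessel_prod (s + 1) w x) \<partial>G\<^sub>2)
      = ennreal (exp ((\<Sum>j\<in>UNIV. w j) / (s + 1)))" if "\<And>j. 0 \<le> w j" for w
    using nn_integral_kingman_conv_vec_bessel_prod[OF s prob sets that]
      nn_integral_rayleigh_vec_bessel_prod[OF s that, where 'a = 'k] assms(4) by simp
  have factor': "(\<integral>\<^sup>+ x. ennreal (bessel_prod (s + 1) w x) \<partial>G\<^sub>2) * (\<integral>\<^sup>+ x. ennreal (bessel_prod (s + 1) w x) \<partial>G\<^sub>1)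
      = ennreal (exp ((\<Sum>j\<in>UNIV. w j) / (s + 1)))" if "\<And>j. 0 \<le> w j" for w
    using factor[OF that] by (simp only: mult.commute)
  have G\<^sub>1: "G\<^sub>1 = vec_prod (\<lambda>r. scale_distr (l\<^sub>1 r) (rayleigh s))"
    unfolding l\<^sub>1_def m\<^sub>1_def by (rule factor_of_rayleigh_transform(1)[OF s prob sets AE(1) factor]) simp
  have G\<^sub>2: "G\<^sub>2 = vec_prod (\<lambda>r. scale_distr (l\<^sub>2 r) (rayleigh s))"
    unfolding l\<^sub>2_def m\<^sub>2_def by (rule factor_of_rayleigh_transform(1)[OF s prob(2,1) sets(2,1) AE(2) factor']) simp
  have "(l\<^sub>1 r)\<^sup>2 + (l\<^sub>2 r)\<^sup>2 = 1" for r
  proof -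
    \<comment> \<open>A unit weight vector isolates coordinate r: the product of the two transforms
      then yields \<open>m\<^sub>1 r + m\<^sub>2 r = 1\<close>.\<close>
    define w :: "'k \<Rightarrow> real" where "w j = (if j = r then 1 else 0)" for j
    have w: "0 \<le> w j" for j by (simp add: w_def)
    have single: "(\<Sum>j\<in>UNIV. w j * c j) = c r" for c
      by (simp add: w_def if_distrib[of "\<lambda>x. x * _"] cong: if_cong)
    have "(\<integral>\<^sup>+ x. ennreal (bessel_prod (s + 1) w x) \<partial>G\<^sub>1) = ennreal (exp ((\<Sum>j\<in>UNIV. w j * m\<^sub>1 j) / (s + 1)))"
      unfolding m\<^sub>1_def by (rule factor_of_rayleigh_transform(2)[OF s prob sets AE(1) factor]) (simp_all add: w)
    moreover have "(\<integral>\<^sup>+ x. ennreal (bessel_prod (s + 1) w x) \<partial>G\<^sub>2) = ennreal (exp ((\<Sum>j\<in>UNIV. w j * m\<^sub>2 j) / (s + 1)))"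
      unfolding m\<^sub>2_def by (rule factor_of_rayleigh_transform(2)[OF s prob(2,1) sets(2,1) AE(2) factor']) (simp_all add: w)
    ultimately have "ennreal (exp (m\<^sub>1 r / (s + 1))) * ennreal (exp (m\<^sub>2 r / (s + 1))) = ennreal (exp (1 / (s + 1)))"
      using factor[of w, OF w] single[of "\<lambda>_. 1"] by (simp add: single)
    then have "exp (m\<^sub>1 r / (s + 1) + m\<^sub>2 r / (s + 1)) = exp (1 / (s + 1))"
      by (simp add: exp_add flip: ennreal_mult)
    then have "(m\<^sub>1 r + m\<^sub>2 r) / (s + 1) = 1 / (s + 1)" by (simp add: add_divide_distrib)
    then show ?thesis using s m by (simp add: l\<^sub>1_def l\<^sub>2_def)
  qed
  moreover have "int (card {r. l\<^sub>1 r \<noteq> 0}) = distr_dim G\<^sub>1" "int (card {r. l\<^sub>2 r \<noteq> 0}) = distr_dim G\<^sub>2"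
    by (subst G\<^sub>1, rule distr_dim_prod_scale_rayleigh[of s l\<^sub>1, OF s l(1), symmetric])
       (subst G\<^sub>2, rule distr_dim_prod_scale_rayleigh[of s l\<^sub>2, OF s l(2), symmetric])
  moreover have "rayleighian s G\<^sub>1" "rayleighian s G\<^sub>2"
    unfolding rayleighian_def
    by (intro exI[of _ l\<^sub>1] conjI allI l G\<^sub>1) (intro exI[of _ l\<^sub>2] conjI allI l G\<^sub>2)
  ultimately show ?thesis
    using l G\<^sub>1 G\<^sub>2 by (intro conjI exI[of _ l\<^sub>1] exI[of _ l\<^sub>2] allI)
qed

end
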